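(* Let $B\subseteq[m]\times[n]$ be a board and $d\ge 0$ an integer. Then for every prime power $q$, $$M_d(B,q)\equiv r_d(B)+(q-1)\bigl(r_{\mathsf{ZG},d-2}(B)-r_{\mathsf{SG},d-2}(B)+r_{\mathsf{WRG},d-1}(B)+r_{\mathsf{WCG},d-1}(B)\bigr)\pmod{(q-1)^2}.$$
   Context: Notation: $[n]=\{1,\dots,n\}$. A board is a subset $B\subseteq[m]\times[n]$. The rook number $r_d(B)$ is the number of ways to choose $d$ cells of $B$ with no two in the same row or column. For a prime power $q>1$, $\mathfrak m_d(B,q)$ is the number of $m\times n$ matrices over $\mathbb F_q$ of rank $d$ whose support (set of positions of nonzero entries) is contained in $B$; $M_d(B,q)=\mathfrak m_d(B,q)/(q-1)^d$, which is known to be an integer. A bi-colored graph is a graph whose vertices are partitioned into row vertices and column vertices, every edge joining a row vertex to a column vertex; isomorphisms must preserve the two classes. For a board $B\subseteq[m]\times[n]$, $G(B)$ is the bi-colored graph with row vertices $[m]$, column vertices $[n]$, and edge set $B$. Let $\mathsf E$ be the graph with one row vertex, one column vertex and one edge, and $\mathsf E^i$ the disjoint union of $i$ copies of it. For a bi-colored graph $F$ and integer $i\ge0$, $r_{F,i}(B)$ is the number of boards $\sigma\subseteq B$ with $G(\sigma)\cong F\sqcup\mathsf E^i\sqcup R$, where $R$ is the edgeless bi-colored graph with the number of row and column vertices needed so that the totals are $m$ and $n$ ($r_{F,i}(B)=0$ if this is impossible). By convention $r_{F,i}(B)=0$ for $i<0$. The four graphs are: $\mathsf{ZG}$, with 2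 row and 2 column vertices, forming a path with 3 edges; $\mathsf{SG}$, with 2 row and 2 column vertices, forming $K_{2,2}$; $\mathsf{WCG}$, with 1 row vertex adjacent to each of 2 column vertices; $\mathsf{WRG}$, with 1 column vertex adjacent to each of 2 row vertices. *)

theory Defs
  imports "Jordan_Normal_Form.DL_Rank" "HOL-Number_Theory.Cong" "HOL-Library.Cardinality"
begin

type_synonym board = "(nat \<times> nat) set"

definition rook_number :: "nat \<Rightarrow> board \<Rightarrow> nat" where
  "rook_number d B = card {\<sigma>. \<sigma> \<subseteq> B \<and> finite \<sigma> \<and> card \<sigma> = d \<and>
     (\<forall>x\<in>\<sigma>. \<forall>y\<in>\<sigma>. x \<noteq> y \<longrightarrow> fst x \<noteq> fst y \<and> snd x \<noteq> snd y)}"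

(* Boards are indexed from 1, matrices from 0. *)
definition mat_support :: "'a::zero mat \<Rightarrow> board" where
  "mat_support A = {(Suc i, Suc j) | i j. i < dim_row A \<and> j < dim_col A \<and> A $$ (i, j) \<noteq> 0}"

(* A finite field of order q is a type of class field and finite with CARD('a) = q; such a
   cardinality is always a prime power greater than 1.  The count depends on the field
   through the type argument. *)
definition mat_count :: "'a::{field,finite} itself \<Rightarrow> nat \<Rightarrow> nat \<Rightarrow> nat \<Rightarrow> board \<Rightarrow> nat" where
  "mat_count _ m n d B =
     card {A :: 'a mat. A \<in> carrier_mat m n \<and> vec_space.rank m A = d \<and> mat_support A \<subseteq> B}"

definition norm_mat_count :: "'a::{field,finite} itself \<Rightarrow> nat \<Rightarrow> nat \<Rightarrow> nat \<Rightarrow> board \<Rightarrow> rat" where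
  "norm_mat_count F m n d B = of_nat (mat_count F m n d B) / (of_nat CARD('a) - 1) ^ d"

datatype ('r, 'c) bigraph =
  Bigraph (row_verts: "'r set") (col_verts: "'c set") (edges: "('r \<times> 'c) set")

definition bigraph_iso :: "('r, 'c) bigraph \<Rightarrow> ('s, 'd) bigraph \<Rightarrow> bool" where
  "bigraph_iso G H \<longleftrightarrow> (\<exists>f g. bij_betw f (row_verts G) (row_verts H) \<and>
     bij_betw g (col_verts G) (col_verts H) \<and>
     (\<forall>r\<in>row_verts G. \<forall>c\<in>col_verts G. (r, c) \<in> edges G \<longleftrightarrow> (f r, g c) \<in> edges H))"

definition bigraph_union ::
  "('r, 'c) bigraph \<Rightarrow> ('s, 'd) bigraph \<Rightarrow> ('r + 's, 'c + 'd) bigraph" where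
  "bigraph_union G H = Bigraph (row_verts G <+> row_verts H) (col_verts G <+> col_verts H)
     (map_prod Inl Inl ` edges G \<union> map_prod Inr Inr ` edges H)"

definition bigraph_copies :: "nat \<Rightarrow> ('r, 'c) bigraph \<Rightarrow> (nat \<times> 'r, nat \<times> 'c) bigraph" where
  "bigraph_copies i G = Bigraph ({1..i} \<times> row_verts G) ({1..i} \<times> col_verts G)
     {((k, r), (k, c)) | k r c. k \<in> {1..i} \<and> (r, c) \<in> edges G}"

definition edgeless :: "nat \<Rightarrow> nat \<Rightarrow> (nat, nat) bigraph" where
  "edgeless a b = Bigraph {1..a} {1..b} {}"

definition board_graph :: "nat \<Rightarrow> nat \<Rightarrow> board \<Rightarrow> (nat, nat) bigraph" where
  "board_graph m n B = Bigraph {1..m} {1..n} B"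

definition EG :: "(nat, nat) bigraph" where
  "EG = Bigraph {1} {1} {(1, 1)}"

definition ZG :: "(nat, nat) bigraph" where
  "ZG = Bigraph {1, 2} {1, 2} {(1, 1), (1, 2), (2, 2)}"

definition SG :: "(nat, nat) bigraph" where
  "SG = Bigraph {1, 2} {1, 2} ({1, 2} \<times> {1, 2})"

definition WCG :: "(nat, nat) bigraph" where
  "WCG = Bigraph {1} {1, 2} {(1, 1), (1, 2)}"

definition WRG :: "(nat, nat) bigraph" where
  "WRG = Bigraph {1, 2} {1} {(1, 1), (2, 1)}"

(* The isomorphism forces the sizes a, b of the edgeless part to be the ones completing the
   vertex counts to m and n; if there are none, the set is empty and the count is 0. *)
definition graph_rook_number ::
  "('r, 'c) bigraph \<Rightarrow> int \<Rightarrow> nat \<Rightarrow> nat \<Rightarrow> board \<Rightarrow> nat" where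
  "graph_rook_number F i m n B = (if i < 0 then 0 else
     card {\<sigma>. \<sigma> \<subseteq> B \<and> (\<exists>a b. bigraph_iso (board_graph m n \<sigma>)
       (bigraph_union (bigraph_union F (bigraph_copies (nat i) EG)) (edgeless a b)))})"

end

theory Submission
  imports Defs
begin

text \<open>Rescaling rows and columns by nonzero scalars preserves support and rank. If \<open>F\<close> is a forest inside
  a support \<open>\<sigma>\<close>, this torus acts transitively on the nonzero values on \<open>F\<close>, so the number of rank \<open>d\<close>
  matrices with support \<open>\<sigma>\<close> is \<open>(q - 1) ^ card F\<close> times the number of those with all entries on \<open>F\<close>
  equal to 1. A support of a rank \<open>d\<close> matrix contains a rook placement \<open>\<mu>\<close> of size \<open>d\<close>. Contract the edges
  of \<open>\<mu>\<close>: if two of the remaining edges do not become parallel, adding them to \<open>\<mu>\<close> gives a forest with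
  \<open>d + 2\<close> edges, and the support contributes 0 modulo \<open>(q - 1)\<^sup>2\<close> after division by \<open>(q - 1) ^ d\<close>.
  Otherwise there are at most two remaining edges, and \<open>\<sigma>\<close> is a rook placement or one of the four graphs
  together with isolated edges. The only weight that is not a power of \<open>q - 1\<close> is that of \<open>SG\<close>, where the
  fourth entry of the square must differ from 0 and 1; this gives \<open>q - 2 \<equiv> -1\<close>.\<close>

section \<open>Rank and rook placements\<close>

definition fun_supp :: "('b \<Rightarrow> 'a::zero) \<Rightarrow> 'b set" where
  "fun_supp f = {x. f x \<noteq> 0}"

text \<open>Independence refers to index sets, not to sets of column vectors, so equal columns at
  different indices are dependent. The row index ranges over a whole type; deleting a row means
  setting it to zero.\<close>

definition col_indep :: "('r \<times> 'c \<Rightarrow> 'a::field) \<Rightarrow> 'c set \<Rightarrow> bool" where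
  "col_indep f J \<longleftrightarrow> finite J \<and>
     (\<forall>a. (\<forall>i. (\<Sum>j\<in>J. a j * f (i, j)) = 0) \<longrightarrow> (\<forall>j\<in>J. a j = 0))"

text \<open>A relation instead of a function, since an \<open>f\<close> with infinite support may
  have independent column sets of unbounded size.\<close>

definition has_rank :: "('r \<times> 'c \<Rightarrow> 'a::field) \<Rightarrow> nat \<Rightarrow> bool" where
  "has_rank f d \<longleftrightarrow> (\<exists>J. col_indep f J \<and> card J = d) \<and> (\<forall>J. col_indep f J \<longrightarrow> card J \<le> d)"

definition rook_placement :: "('r \<times> 'c) set \<Rightarrow> bool" where
  "rook_placement \<mu> \<longleftrightarrow> finite \<mu> \<and> inj_on fst \<mu> \<and> inj_on snd \<mu>"

lemma col_indepD:
  assumes "col_indep f J" "\<And>i. (\<Sum>j\<in>J. a j * f (i, j)) = 0" "j \<in> J"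
  shows "a j = 0"
  using assms unfolding col_indep_def by blast

lemma col_indep_empty [simp]: "col_indep f {}"
  by (simp add: col_indep_def)

lemma has_rank_unique: "has_rank f d \<Longrightarrow> has_rank f d' \<Longrightarrow> d = d'"
  unfolding has_rank_def using le_antisym by blast

lemma rook_placement_empty [simp]: "rook_placement {}"
  by (simp add: rook_placement_def)

lemma rook_placement_insert:
  assumes "rook_placement \<mu>" "i \<notin> fst ` \<mu>" "j \<notin> snd ` \<mu>"
  shows "rook_placement (insert (i, j) \<mu>)"
  using assms unfolding rook_placement_def by (auto simp: inj_on_insert)

lemma rook_placement_subset: "rook_placement \<mu> \<Longrightarrow> \<nu> \<subseteq> \<mu> \<Longrightarrow> rook_placement \<nu>"
  by (auto simp: rook_placement_def intro: finite_subset inj_on_subset)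

lemma rook_placementD:
  assumes "rook_placement \<mu>" "(i, j) \<in> \<mu>" "(i', j') \<in> \<mu>"
  shows "i = i' \<longleftrightarrow> j = j'"
proof -
  have "inj_on fst \<mu>" "inj_on snd \<mu>" using assms(1) by (auto simp: rook_placement_def)
  from inj_onD[OF this(1) _ assms(2,3)] inj_onD[OF this(2) _ assms(2,3)] show ?thesis by auto
qed

lemma rook_placement_induct [consumes 1, case_names empty insert]:
  assumes "rook_placement \<mu>" "P {}"
    and "\<And>i j \<mu>. rook_placement \<mu> \<Longrightarrow> i \<notin> fst ` \<mu> \<Longrightarrow> j \<notin> snd ` \<mu> \<Longrightarrow> P \<mu> \<Longrightarrow> P (insert (i, j) \<mu>)"
  shows "P \<mu>"
proof -
  have "finite \<mu>" using assms(1) by (simp add: rook_placement_def)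
  then show ?thesis using assms(1)
  proof (induction \<mu>)
    case empty
    show ?case by (rule assms(2))
  next
    case (insert x \<mu>)
    obtain i j where x: "x = (i, j)" by force
    have r: "rook_placement \<mu>" using insert.prems rook_placement_subset by blast
    have "i \<notin> fst ` \<mu>" "j \<notin> snd ` \<mu>"
      using insert.prems insert.hyps(2) unfolding x rook_placement_def by (simp_all add: inj_on_insert)
    then show ?case using assms(3) r insert.IH x by blast
  qed
qed

lemma card_rook_placement:
  assumes "rook_placement \<mu>"
  shows "card (fst ` \<mu>) = card \<mu>" "card (snd ` \<mu>) = card \<mu>"
  using assms by (auto simp: rook_placement_def card_image)

text \<open>If every unit vector in the support of column \<open>j0\<close> were spanned by the remaining columns, then so
  would be column \<open>j0\<close>; hence one row of that support can be deleted together with \<open>j0\<close>.\<close>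

lemma col_indep_delete_row:
  fixes f :: "'r \<times> 'c \<Rightarrow> 'a::field"
  assumes ind: "col_indep f (insert j0 J)" and j0: "j0 \<notin> J" and fin: "finite (fun_supp f)"
  obtains i0 where "f (i0, j0) \<noteq> 0" "col_indep (\<lambda>(i, j). if i = i0 then 0 else f (i, j)) J"
proof (rule ccontr)
  assume "\<not> thesis"
  then have no: "\<not> col_indep (\<lambda>(i, j). if i = i0 then 0 else f (i, j)) J"
    if "f (i0, j0) \<noteq> 0" for i0
    using that \<open>\<And>i0. f (i0, j0) \<noteq> 0 \<Longrightarrow> col_indep (\<lambda>(i, j). if i = i0 then 0 else f (i, j)) J \<Longrightarrow> thesis\<close> by blast
  have finJ: "finite J" using ind by (simp add: col_indep_def)
  define I where "I = {i. f (i, j0) \<noteq> 0}"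
  have "I \<subseteq> fst ` fun_supp f" by (force simp: I_def fun_supp_def)
  then have finI: "finite I" using fin finite_surj by blast
  \<comment> \<open>If deleting row \<open>i0\<close> makes the columns in \<open>J\<close>
    dependent, the same combination of the full columns is supported on row \<open>i0\<close> alone;
    division by its entry \<open>s\<close> there gives the unit vector.\<close>
  have "\<exists>b. \<forall>i. (\<Sum>j\<in>J. b j * f (i, j)) = (if i = i0 then 1 else 0)" if "i0 \<in> I" for i0
  proof -
    obtain a j1 where a: "\<And>i. i \<noteq> i0 \<Longrightarrow> (\<Sum>j\<in>J. a j * f (i, j)) = 0" and j1: "j1 \<in> J" "a j1 \<noteq> 0"
    proof -
      obtain a where "\<forall>i. (\<Sum>j\<in>J. a j * (if i = i0 then 0 else f (i, j))) = 0" "\<exists>j\<in>J. a j \<noteq> 0"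
      proof -
        have "f (i0, j0) \<noteq> 0" using \<open>i0 \<in> I\<close> by (simp add: I_def)
        from no[OF this] finJ show ?thesis using that by (auto simp: col_indep_def)
      qed
      moreover from this(1) have "(\<Sum>j\<in>J. a j * f (i, j)) = 0" if "i \<noteq> i0" for i
        using that by (auto dest: spec[of _ i])
      ultimately show ?thesis using that by blast
    qed
    define s where "s = (\<Sum>j\<in>J. a j * f (i0, j))"
    \<comment> \<open>Otherwise \<open>a\<close>, extended by 0 at \<open>j0\<close>, would be a
      nontrivial relation among the columns in \<open>insert j0 J\<close>.\<close>
    have "s \<noteq> 0"
    proof
      assume "s = 0"
      then have z: "(\<Sum>j\<in>J. a j * f (i, j)) = 0" for i using a[of i] s_def by (cases "i = i0") auto
      have "(\<Sum>j\<in>insert j0 J. (a(j0 := 0)) j * f (i, j)) = 0" for i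
      proof -
        have "(\<Sum>j\<in>J. (a(j0 := 0)) j * f (i, j)) = (\<Sum>j\<in>J. a j * f (i, j))"
          using j0 by (intro sum.cong) auto
        then show ?thesis using j0 finJ z by simp
      qed
      then have "(a(j0 := 0)) j1 = 0" by (rule col_indepD[OF ind]) (use j1 in auto)
      then show False using j1 j0 by (auto split: if_splits)
    qed
    have "(\<Sum>j\<in>J. a j / s * f (i, j)) = (if i = i0 then 1 else 0)" for i
    proof -
      have "(\<Sum>j\<in>J. a j / s * f (i, j)) = (\<Sum>j\<in>J. a j * f (i, j)) / s"
        by (simp add: sum_divide_distrib)
      then show ?thesis using a \<open>s \<noteq> 0\<close> s_def by simp
    qed
    then show ?thesis by (intro exI[of _ "\<lambda>j. a j / s"] allI)
  qed
  then obtain b where b: "\<And>i0 i. i0 \<in> I \<Longrightarrow> (\<Sum>j\<in>J. b i0 j * f (i, j)) = (if i = i0 then 1 else 0)"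
    by metis
  \<comment> \<open>Coefficients of column \<open>j0\<close> minus its expansion in unit vectors,
    each unit vector being written through the columns in \<open>J\<close>.\<close>
  define a where "a j = (if j = j0 then 1 else - (\<Sum>i0\<in>I. f (i0, j0) * b i0 j))" for j
  have "(\<Sum>j\<in>insert j0 J. a j * f (i, j)) = 0" for i
  proof -
    have "(\<Sum>j\<in>J. a j * f (i, j)) = (\<Sum>j\<in>J. - (\<Sum>i0\<in>I. f (i0, j0) * b i0 j) * f (i, j))"
      using j0 by (intro sum.cong) (auto simp: a_def)
    also have "\<dots> = - (\<Sum>j\<in>J. \<Sum>i0\<in>I. f (i0, j0) * b i0 j * f (i, j))"
      by (simp add: sum_distrib_right sum_negf)
    also have "\<dots> = - (\<Sum>i0\<in>I. f (i0, j0) * (\<Sum>j\<in>J. b i0 j * f (i, j)))"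
      by (subst sum.swap) (simp add: sum_distrib_left mult.assoc)
    also have "\<dots> = - (\<Sum>i0\<in>I. f (i0, j0) * (if i = i0 then 1 else 0))"
      using b by simp
    also have "\<dots> = - f (i, j0)"
      using finI by (auto simp: I_def if_distrib[of "\<lambda>x. _ * x"] cong: if_cong)
    finally show ?thesis using j0 finJ by (simp add: a_def)
  qed
  then have "a j0 = 0" by (rule col_indepD[OF ind]) auto
  then show False by (simp add: a_def)
qed

text \<open>This plays the part of a nonzero term in the Leibniz expansion of a nonzero minor. Each
  induction step keeps one cell of column \<open>j0\<close> and deletes its row, so the other cells
  cannot reuse that row.\<close>

lemma col_indep_rook_placement:
  fixes f :: "'r \<times> 'c \<Rightarrow> 'a::field"
  assumes "col_indep f J" "finite (fun_supp f)"
  shows "\<exists>\<mu>\<subseteq>fun_supp f. rook_placement \<mu> \<and> snd ` \<mu> = J"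
proof -
  have "finite J" using assms(1) by (simp add: col_indep_def)
  then show ?thesis using assms
  proof (induction J arbitrary: f)
    case empty
    then show ?case by (intro exI[of _ "{}"]) auto
  next
    case (insert j0 J)
    obtain i0 where i0: "f (i0, j0) \<noteq> 0"
      and ind: "col_indep (\<lambda>(i, j). if i = i0 then 0 else f (i, j)) J" (is "col_indep ?g J")
      using col_indep_delete_row[OF insert.prems(1) insert.hyps(2) insert.prems(2)] by blast
    have sub: "fun_supp ?g \<subseteq> fun_supp f" by (auto simp: fun_supp_def split: if_splits)
    then obtain \<mu> where \<mu>: "\<mu> \<subseteq> fun_supp ?g" "rook_placement \<mu>" "snd ` \<mu> = J"
      using insert.IH[OF ind] insert.prems(2) finite_subset by blast
    have "i0 \<notin> fst ` \<mu>" using \<mu>(1) by (auto simp: fun_supp_def)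
    then have "rook_placement (insert (i0, j0) \<mu>)"
      using \<mu> insert.hyps by (intro rook_placement_insert) auto
    moreover have "insert (i0, j0) \<mu> \<subseteq> fun_supp f" using i0 \<mu>(1) sub by (auto simp: fun_supp_def)
    ultimately show ?case using \<mu>(3) by (intro exI[of _ "insert (i0, j0) \<mu>"]) auto
  qed
qed

text \<open>Evaluating a relation at the pivot row \<open>i0\<close> leaves only the term of
  \<open>j0\<close>; its coefficient vanishes and the rest is a relation on
  \<open>J\<close>.\<close>

lemma col_indep_insert:
  assumes "col_indep f J" "\<And>j. j \<in> J \<Longrightarrow> f (i0, j) = 0" "f (i0, j0) \<noteq> 0"
  shows "col_indep f (insert j0 J)"
  unfolding col_indep_def
proof (intro conjI allI impI)
  show "finite (insert j0 J)" using assms(1) by (simp add: col_indep_def)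
  have fin: "finite J" using assms(1) by (simp add: col_indep_def)
  have j0: "j0 \<notin> J" using assms by blast
  fix a assume a: "\<forall>i. (\<Sum>j\<in>insert j0 J. a j * f (i, j)) = 0"
  have "(\<Sum>j\<in>J. a j * f (i0, j)) = 0" using assms(2) by simp
  then have "a j0 = 0" using a[rule_format, of i0] fin j0 assms(3) by simp
  then have "\<forall>i. (\<Sum>j\<in>J. a j * f (i, j)) = 0" using a fin j0 by simp
  then have "\<forall>j\<in>J. a j = 0" using assms(1) unfolding col_indep_def by (elim conjE) (drule spec, erule mp)
  then show "\<forall>j\<in>insert j0 J. a j = 0" using \<open>a j0 = 0\<close> by simp
qed

text \<open>A row of \<open>\<mu>\<close> has no nonzero entry outside \<open>\<mu>\<close>, so it
  is a pivot row for its own column, and the columns of \<open>\<mu>\<close> can be inserted one at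
  a time.\<close>

lemma col_indep_Un_rook_placement:
  assumes "rook_placement \<mu>" "col_indep f J" "\<mu> \<subseteq> fun_supp f" "snd ` \<mu> \<inter> J = {}"
    and "\<And>i j. i \<in> fst ` \<mu> \<Longrightarrow> f (i, j) \<noteq> 0 \<Longrightarrow> (i, j) \<in> \<mu>"
  shows "col_indep f (snd ` \<mu> \<union> J)"
proof -
  \<comment> \<open>Only the sub-placement \<open>\<nu>\<close> varies in the induction; the row
    condition keeps referring to all of \<open>\<mu>\<close>.\<close>
  have "col_indep f (snd ` \<nu> \<union> J)" if "\<nu> \<subseteq> \<mu>" "rook_placement \<nu>" for \<nu>
    using that(2,1)
  proof (induction rule: rook_placement_induct)
    case empty
    show ?case using assms(2) by simp
  next
    case (insert i0 j0 \<nu>)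
    have "col_indep f (insert j0 (snd ` \<nu> \<union> J))"
    proof (rule col_indep_insert)
      show "col_indep f (snd ` \<nu> \<union> J)" using insert by blast
      show "f (i0, j0) \<noteq> 0" using insert.prems assms(3) by (auto simp: fun_supp_def)
      fix j assume j: "j \<in> snd ` \<nu> \<union> J"
      show "f (i0, j) = 0"
      proof (rule ccontr)
        assume "f (i0, j) \<noteq> 0"
        then have "(i0, j) \<in> \<mu>" using assms(5) insert.prems by force
        then have "j = j0" using rook_placementD[OF assms(1)] insert.prems by blast
        then show False using j insert.hyps assms(4) insert.prems by force
      qed
    qed
    then show ?case by simp
  qed
  then show ?thesis using assms(1) by blast
qed

text \<open>The upper bound holds because independent columns carry a rook placement of the same
  size inside the support.\<close>

lemma has_rankI:
  assumes "finite (fun_supp f)" "col_indep f J" "card J = d"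
    and "\<And>\<mu>. \<mu> \<subseteq> fun_supp f \<Longrightarrow> rook_placement \<mu> \<Longrightarrow> card \<mu> \<le> d"
  shows "has_rank f d"
  unfolding has_rank_def
proof (intro conjI allI impI)
  show "\<exists>J. col_indep f J \<and> card J = d" using assms by blast
  fix J assume "col_indep f J"
  then obtain \<mu> where "\<mu> \<subseteq> fun_supp f" "rook_placement \<mu>" "snd ` \<mu> = J"
    using col_indep_rook_placement assms(1) by blast
  then show "card J \<le> d" using assms(4)[of \<mu>] card_rook_placement(2)[of \<mu>] by simp
qed

lemma has_rank_rook_placement:
  assumes "has_rank f d" "finite (fun_supp f)"
  obtains \<mu> where "\<mu> \<subseteq> fun_supp f" "rook_placement \<mu>" "card \<mu> = d"
proof -
  obtain J where "col_indep f J" "card J = d" using assms(1) by (auto simp: has_rank_def)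
  moreover from this obtain \<mu> where "\<mu> \<subseteq> fun_supp f" "rook_placement \<mu>" "snd ` \<mu> = J"
    using col_indep_rook_placement assms(2) by blast
  ultimately show ?thesis using that card_rook_placement(2)[of \<mu>] by simp
qed

section \<open>Agreement with the rank of a matrix\<close>

text \<open>\<open>f\<close> is \<open>A\<close> with indices shifted to start at 1 and extended by
  zero. The work lies in passing between index sets and sets of column vectors: independent indices
  give distinct independent columns, and a maximal independent set of columns is represented by one
  index per vector.\<close>

lemma has_rank_vec_space_rank:
  fixes A :: "'a::field mat"
  assumes A: "A \<in> carrier_mat m n"
    and f: "\<And>i j. f (i, j) = (if i \<in> {1..m} \<and> j \<in> {1..n} then A $$ (i - 1, j - 1) else 0)"
  shows "has_rank f (vec_space.rank m A)"
proof -
  interpret vec_space "TYPE('a)" m .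
  have cA: "set (cols A) = (\<lambda>j. col A (j - 1)) ` {1..n}"
  proof -
    have "set (cols A) = col A ` {..<n}" using A by (auto simp: cols_def)
    also have "{..<n} = (\<lambda>j. j - 1) ` {1..n}" by (force simp: image_iff)
    finally show ?thesis by (simp add: image_image)
  qed
  have cc: "set (cols A) \<subseteq> carrier_vec m" using A cols_dim by blast
  have ge: "card J \<le> rank A" if J: "col_indep f J" for J
  proof -
    have finJ: "finite J" using J by (simp add: col_indep_def)
    \<comment> \<open>Outside \<open>{1..n}\<close> the columns of \<open>f\<close> are zero, and a
      zero column is dependent on its own.\<close>
    have Jn: "J \<subseteq> {1..n}"
    proof (rule ccontr)
      assume "\<not> J \<subseteq> {1..n}"
      then obtain j0 where j0: "j0 \<in> J" "j0 \<notin> {1..n}" by blast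
      have "(\<Sum>j\<in>J. (if j = j0 then 1 else 0) * f (i, j)) = 0" for i
        using j0 f by (intro sum.neutral) auto
      then have "(if j0 = j0 then 1 else 0) = (0::'a)" by (rule col_indepD[OF J]) (rule j0)
      then show False by simp
    qed
    have inj: "inj_on (\<lambda>j. col A (j - 1)) J"
    proof (rule inj_onI, rule ccontr)
      fix j1 j2 assume j: "j1 \<in> J" "j2 \<in> J" "col A (j1 - 1) = col A (j2 - 1)" "j1 \<noteq> j2"
      have e: "f (i, j1) = f (i, j2)" for i
      proof (cases "i \<in> {1..m}")
        case True
        have "col A (j1 - 1) $ (i - 1) = col A (j2 - 1) $ (i - 1)" using j by simp
        moreover have "i - 1 < m" "j1 - 1 < n" "j2 - 1 < n"
          using True subsetD[OF Jn j(1)] subsetD[OF Jn j(2)] by auto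
        ultimately show ?thesis using True j Jn f A by auto
      qed (auto simp: f)
      \<comment> \<open>The difference of two equal columns is a nontrivial relation.\<close>
      define a :: "nat \<Rightarrow> 'a" where "a = (\<lambda>j. if j = j1 then 1 else if j = j2 then -1 else 0)"
      have "(\<Sum>j\<in>J. a j * f (i, j)) = 0" for i
      proof -
        have "(\<Sum>j\<in>J. a j * f (i, j)) = (\<Sum>j\<in>{j1, j2}. a j * f (i, j))"
          using finJ j by (intro sum.mono_neutral_right) (auto simp: a_def)
        then show ?thesis using j e by (simp add: a_def)
      qed
      then have "a j1 = 0" by (rule col_indepD[OF J]) (rule j)
      then show False by (simp add: a_def)
    qed
    let ?U = "(\<lambda>j. col A (j - 1)) ` J"
    have U: "?U \<subseteq> set (cols A)" using cA Jn by auto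
    have "lin_indpt ?U"
    proof
      assume "lin_dep ?U"
      then obtain a w where aw: "lincomb a ?U = 0\<^sub>v m" "w \<in> ?U" "a w \<noteq> 0"
        using finite_lin_dep[of ?U] finJ U cc by auto
      have "(\<Sum>j\<in>J. a (col A (j - 1)) * f (i, j)) = 0" for i
      proof (cases "i \<in> {1..m}")
        case True
        then have i: "i - 1 < m" by auto
        have "0 = lincomb a ?U $ (i - 1)" using aw(1) i by simp
        also have "\<dots> = (\<Sum>x\<in>?U. a x * x $ (i - 1))"
          using U cc by (intro lincomb_index[OF i]) auto
        also have "\<dots> = (\<Sum>j\<in>J. a (col A (j - 1)) * col A (j - 1) $ (i - 1))"
          using inj by (simp add: sum.reindex)
        also have "\<dots> = (\<Sum>j\<in>J. a (col A (j - 1)) * f (i, j))"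
        proof (intro sum.cong refl)
          fix j assume "j \<in> J"
          then have "j \<in> {1..n}" using Jn by blast
          moreover from this have "j - 1 < n" by auto
          ultimately show "a (col A (j - 1)) * col A (j - 1) $ (i - 1) = a (col A (j - 1)) * f (i, j)"
            using True i A f by auto
        qed
        finally show ?thesis by simp
      qed (auto simp: f)
      then have "a (col A (j - 1)) = 0" if "j \<in> J" for j
        by (rule col_indepD[OF J]) (rule that)
      then show False using aw by auto
    qed
    from rank_ge_card_indpt[OF A U this] show ?thesis using inj by (simp add: card_image)
  qed
  obtain S where S: "maximal S (\<lambda>T. T \<subseteq> set (cols A) \<and> lin_indpt T)"
    using maximal_exists[of "(\<lambda>T. T \<subseteq> set (cols A) \<and> lin_indpt T)" "card (set (cols A))" "{}"]
    by (meson List.finite_set card_mono empty_iff empty_subsetI finite_lin_indpt2 rev_finite_subset)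
  have rS: "rank A = card S" using rank_card_indpt[OF A S] .
  have S1: "S \<subseteq> (\<lambda>j. col A (j - 1)) ` {1..n}" and S2: "lin_indpt S"
    using S cA unfolding maximal_def by auto
  \<comment> \<open>A vector may occur at several column indices; \<open>J\<close> selects exactly
    one index for each member of \<open>S\<close>.\<close>
  obtain J where J: "J \<subseteq> {1..n}" "inj_on (\<lambda>j. col A (j - 1)) J" "S = (\<lambda>j. col A (j - 1)) ` J"
    using S1 by (meson subset_image_inj)
  have finJ: "finite J" using J(1) finite_subset by blast
  have "col_indep f J"
    unfolding col_indep_def
  proof (intro conjI allI impI finJ ballI)
    fix a j0 assume a: "\<forall>i. (\<Sum>j\<in>J. a j * f (i, j)) = 0" and j0: "j0 \<in> J"
    \<comment> \<open>\<open>b\<close> moves the coefficients from indices to vectors; by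
      injectivity on \<open>J\<close> each vector receives the coefficient of its own index.\<close>
    define b where "b v = a (inv_into J (\<lambda>j. col A (j - 1)) v)" for v
    have b: "b (col A (j - 1)) = a j" if "j \<in> J" for j
      unfolding b_def using inv_into_f_f[OF J(2) that] by simp
    show "a j0 = 0"
    proof (rule ccontr)
      assume "a j0 \<noteq> 0"
      have Sc: "S \<subseteq> carrier_vec m" using cc S1 cA by blast
      have "lincomb b S = 0\<^sub>v m"
      proof (rule eq_vecI)
        show "dim_vec (lincomb b S) = dim_vec (0\<^sub>v m)"
          using lincomb_dim[OF _ Sc] J(3) finJ by simp
        fix i assume "i < dim_vec (0\<^sub>v m)"
        then have i: "i < m" by simp
        have "lincomb b S $ i = (\<Sum>x\<in>S. b x * x $ i)" by (rule lincomb_index[OF i Sc])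
        also have "\<dots> = (\<Sum>j\<in>J. b (col A (j - 1)) * col A (j - 1) $ i)"
          using J by (simp add: sum.reindex)
        also have "\<dots> = (\<Sum>j\<in>J. a j * f (Suc i, j))"
        proof (intro sum.cong refl)
          fix j assume j: "j \<in> J"
          then have "j \<in> {1..n}" using J by blast
          moreover from this have "j - 1 < n" by auto
          ultimately show "b (col A (j - 1)) * col A (j - 1) $ i = a j * f (Suc i, j)"
            using i A f b[OF j] by auto
        qed
        finally show "lincomb b S $ i = 0\<^sub>v m $ i" using a i by simp
      qed
      moreover have "finite S" using J finJ by simp
      ultimately have "lin_dep S"
        using lin_dep_crit[where A = S and S = S and a = b and v = "col A (j0 - 1)"] j0 J(3) b[OF j0] \<open>a j0 \<noteq> 0\<close> by auto
      then show False using S2 by blast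
    qed
  qed
  then show ?thesis
    unfolding has_rank_def using ge rS J card_image by metis
qed

section \<open>Torus action\<close>

text \<open>A finite \<open>F\<close> satisfies this for a field with more than two elements iff it is a forest.\<close>

definition torus_free :: "'a::field itself \<Rightarrow> ('r \<times> 'c) set \<Rightarrow> bool" where
  "torus_free T F \<longleftrightarrow> (\<forall>\<phi> :: 'r \<times> 'c \<Rightarrow> 'a. (\<forall>e\<in>F. \<phi> e \<noteq> 0) \<longrightarrow>
     (\<exists>x y. (\<forall>r. x r \<noteq> 0) \<and> (\<forall>c. y c \<noteq> 0) \<and> (\<forall>r c. (r, c) \<in> F \<longrightarrow> x r * y c = \<phi> (r, c))))"

definition scale :: "('r \<Rightarrow> 'a) \<Rightarrow> ('c \<Rightarrow> 'a) \<Rightarrow> ('r \<times> 'c \<Rightarrow> 'a::field) \<Rightarrow> 'r \<times> 'c \<Rightarrow> 'a" where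
  "scale x y f = (\<lambda>(r, c). x r * y c * f (r, c))"

definition supp_rank_funs :: "('r \<times> 'c) set \<Rightarrow> nat \<Rightarrow> ('r \<times> 'c \<Rightarrow> 'a::field) set" where
  "supp_rank_funs \<sigma> d = {f. fun_supp f = \<sigma> \<and> has_rank f d}"

section \<open>Invariance under rescaling\<close>

lemma fun_supp_scale:
  assumes "\<forall>r. x r \<noteq> 0" "\<forall>c. y c \<noteq> 0"
  shows "fun_supp (scale x y f) = fun_supp f"
  using assms by (auto simp: fun_supp_def scale_def)

lemma scale_inverse:
  assumes "\<forall>r. x r \<noteq> 0" "\<forall>c. y c \<noteq> 0"
  shows "scale x y (scale (\<lambda>r. inverse (x r)) (\<lambda>c. inverse (y c)) f) = f"
    and "scale (\<lambda>r. inverse (x r)) (\<lambda>c. inverse (y c)) (scale x y f) = f"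
  using assms by (auto simp: scale_def field_simps)

text \<open>A relation \<open>a\<close> among the scaled columns is the relation
  \<open>a j * y j\<close> among the original ones, up to the nonzero row factor
  \<open>x i\<close>.\<close>

lemma col_indep_scale:
  assumes "\<forall>r. x r \<noteq> 0" "\<forall>c. y c \<noteq> 0" and ind: "col_indep f J"
  shows "col_indep (scale x y f) J"
  unfolding col_indep_def
proof (intro conjI allI impI ballI)
  show "finite J" using ind by (simp add: col_indep_def)
  fix a j assume a: "\<forall>i. (\<Sum>j\<in>J. a j * scale x y f (i, j)) = 0" and j: "j \<in> J"
  have "(\<Sum>j\<in>J. (a j * y j) * f (i, j)) = 0" for i
  proof -
    have "x i * (\<Sum>j\<in>J. (a j * y j) * f (i, j)) = (\<Sum>j\<in>J. a j * scale x y f (i, j))"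
      by (simp add: sum_distrib_left scale_def algebra_simps)
    then show ?thesis using a assms(1) by simp
  qed
  then have "a j * y j = 0" by (rule col_indepD[OF ind]) (rule j)
  then show "a j = 0" using assms(2) by simp
qed

lemma has_rank_scale:
  assumes "\<forall>r. x r \<noteq> 0" "\<forall>c. y c \<noteq> 0"
  shows "has_rank (scale x y f) d \<longleftrightarrow> has_rank f d"
proof -
  have "col_indep (scale x y f) J \<longleftrightarrow> col_indep f J" for J
  proof
    assume "col_indep (scale x y f) J"
    then have "col_indep (scale (\<lambda>r. inverse (x r)) (\<lambda>c. inverse (y c)) (scale x y f)) J"
      using col_indep_scale[of "\<lambda>r. inverse (x r)" "\<lambda>c. inverse (y c)"] assms by simp
    then show "col_indep f J" using scale_inverse(2)[OF assms] by simp
  qed (rule col_indep_scale[OF assms])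
  then show ?thesis by (simp add: has_rank_def)
qed

lemma scale_in_supp_rank_funs:
  assumes "\<forall>r. x r \<noteq> 0" "\<forall>c. y c \<noteq> 0"
  shows "scale x y f \<in> supp_rank_funs \<sigma> d \<longleftrightarrow> f \<in> supp_rank_funs \<sigma> d"
  by (simp add: supp_rank_funs_def has_rank_scale[OF assms] fun_supp_scale[OF assms])

text \<open>One rescaling is fixed for every choice of nonzero values on \<open>F\<close>; applied
  to the functions that are 1 on \<open>F\<close>, these rescalings hit every member of
  \<open>?S\<close> exactly once. Fixing representatives replaces a computation of orbits and
  stabilisers.\<close>

lemma card_supp_rank_funs:
  fixes F \<sigma> :: "('r \<times> 'c) set"
  assumes free: "torus_free TYPE('a::{field,finite}) F" and F: "F \<subseteq> \<sigma>" "finite F"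
  shows "card (supp_rank_funs \<sigma> d :: ('r \<times> 'c \<Rightarrow> 'a) set) =
    (CARD('a) - 1) ^ card F * card {f :: 'r \<times> 'c \<Rightarrow> 'a. f \<in> supp_rank_funs \<sigma> d \<and> (\<forall>e\<in>F. f e = 1)}"
    (is "card ?S = _ * card ?S1")
proof -
  \<comment> \<open>Extensional functions, so that each assignment of nonzero values to
    \<open>F\<close> is counted once.\<close>
  let ?P = "F \<rightarrow>\<^sub>E (UNIV - {0 :: 'a})"
  let ?Q = "\<lambda>\<phi> x y. (\<forall>r. x r \<noteq> 0) \<and> (\<forall>c. y c \<noteq> 0) \<and>
    (\<forall>r c. (r, c) \<in> F \<longrightarrow> x r * y c = \<phi> (r, c))"
  have "\<forall>\<phi>\<in>?P. \<exists>p. ?Q \<phi> (fst p) (snd p)"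
    using free unfolding torus_free_def by (auto simp: PiE_iff)
  from bchoice[OF this] obtain p where p: "\<forall>\<phi>\<in>?P. ?Q \<phi> (fst (p \<phi>)) (snd (p \<phi>))"
    by blast
  obtain X Y where X: "\<And>\<phi>. \<phi> \<in> ?P \<Longrightarrow> \<forall>r. X \<phi> r \<noteq> 0" and Y: "\<And>\<phi>. \<phi> \<in> ?P \<Longrightarrow> \<forall>c. Y \<phi> c \<noteq> 0"
    and XY: "\<And>\<phi> r c. \<phi> \<in> ?P \<Longrightarrow> (r, c) \<in> F \<Longrightarrow> X \<phi> r * Y \<phi> c = \<phi> (r, c)"
    using p by (intro that[of "\<lambda>\<phi>. fst (p \<phi>)" "\<lambda>\<phi>. snd (p \<phi>)"]) simp_all
  define h where "h = (\<lambda>(\<phi>, g). scale (X \<phi>) (Y \<phi>) g)"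
  have hF: "h (\<phi>, g) e = \<phi> e" if "\<phi> \<in> ?P" "g \<in> ?S1" "e \<in> F" for \<phi> g e
    using that XY by (cases e) (simp add: h_def scale_def)
  have "bij_betw h (?P \<times> ?S1) ?S"
    unfolding bij_betw_def
  proof
    show "inj_on h (?P \<times> ?S1)"
    proof (rule inj_onI, clarify)
      fix \<phi> g \<psi> k
      assume a: "\<phi> \<in> ?P" "\<psi> \<in> ?P" "g \<in> supp_rank_funs \<sigma> d" "\<forall>e\<in>F. g e = 1"
        "k \<in> supp_rank_funs \<sigma> d" "\<forall>e\<in>F. k e = 1" and eq: "h (\<phi>, g) = h (\<psi>, k)"
      \<comment> \<open>Since \<open>g\<close> and \<open>k\<close> are 1 on \<open>F\<close>, the
        common image restricted to \<open>F\<close> recovers both \<open>\<phi>\<close> and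
        \<open>\<psi>\<close>.\<close>
      have "\<phi> e = \<psi> e" if "e \<in> F" for e
        using hF[of \<phi> g e] hF[of \<psi> k e] a eq that by simp
      then have \<phi>: "\<phi> = \<psi>" using a(1,2) by (intro PiE_ext) auto
      have "scale (X \<phi>) (Y \<phi>) g = scale (X \<phi>) (Y \<phi>) k" using eq \<phi> by (simp add: h_def)
      then have "scale (\<lambda>r. inverse (X \<phi> r)) (\<lambda>c. inverse (Y \<phi> c)) (scale (X \<phi>) (Y \<phi>) g) =
        scale (\<lambda>r. inverse (X \<phi> r)) (\<lambda>c. inverse (Y \<phi> c)) (scale (X \<phi>) (Y \<phi>) k)" by simp
      then have "g = k" unfolding scale_inverse(2)[OF X[OF a(1)] Y[OF a(1)]] .
      then show "\<phi> = \<psi> \<and> g = k" using \<phi> by simp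
    qed
    show "h ` (?P \<times> ?S1) = ?S"
    proof
      show "h ` (?P \<times> ?S1) \<subseteq> ?S"
      proof (clarify)
        fix \<phi> g assume "\<phi> \<in> ?P" "g \<in> ?S"
        then show "h (\<phi>, g) \<in> ?S"
          unfolding h_def using scale_in_supp_rank_funs[OF X Y, of \<phi> \<phi>] by simp
      qed
      show "?S \<subseteq> h ` (?P \<times> ?S1)"
      proof
        fix f assume f: "f \<in> ?S"
        \<comment> \<open>The preimage is forced: \<open>\<phi>\<close> must be \<open>f\<close> on
          \<open>F\<close>, and \<open>g\<close> is \<open>f\<close> with the chosen rescaling
          undone.\<close>
        define \<phi> where "\<phi> = restrict f F"
        have \<phi>: "\<phi> \<in> ?P" using f F by (auto simp: \<phi>_def supp_rank_funs_def fun_supp_def)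
        define g where "g = scale (\<lambda>r. inverse (X \<phi> r)) (\<lambda>c. inverse (Y \<phi> c)) f"
        have fg: "f = h (\<phi>, g)" unfolding h_def g_def using scale_inverse(1)[OF X[OF \<phi>] Y[OF \<phi>]] by simp
        have "g \<in> supp_rank_funs \<sigma> d"
          unfolding g_def using f X[OF \<phi>] Y[OF \<phi>] by (subst scale_in_supp_rank_funs) auto
        moreover have "g e = 1" if "e \<in> F" for e
        proof -
          obtain r c where e: "e = (r, c)" by force
          have "f (r, c) = X \<phi> r * Y \<phi> c" using XY[OF \<phi>] that e by (simp add: \<phi>_def)
          then show ?thesis using X[OF \<phi>] Y[OF \<phi>] by (simp add: g_def scale_def e field_simps)
        qed
        ultimately show "f \<in> h ` (?P \<times> ?S1)" using \<phi> fg by blast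
      qed
    qed
  qed
  then have "card ?S = card ?P * card ?S1"
    by (simp add: bij_betw_same_card[symmetric] card_cartesian_product)
  also have "card ?P = (CARD('a) - 1) ^ card F" using F(2) by (simp add: card_funcsetE card_Diff_subset)
  finally show ?thesis .
qed

lemma torus_free_empty [simp]: "torus_free T {}"
  unfolding torus_free_def by (auto intro!: exI[of _ "\<lambda>_. 1"])

text \<open>The vertex set \<open>R \<union> C\<close> is a cut crossed by the new edge but by no edge of \<open>F\<close>: scaling its rows by
  \<open>t\<close> and its columns by \<open>1 / t\<close> changes the value on the new edge only.\<close>

lemma torus_free_insert:
  assumes free: "torus_free TYPE('a::field) F"
    and F: "\<And>r c. (r, c) \<in> F \<Longrightarrow> r \<in> R \<longleftrightarrow> c \<in> C" and e: "(r0 \<in> R) \<noteq> (c0 \<in> C)"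
  shows "torus_free TYPE('a) (insert (r0, c0) F)"
  unfolding torus_free_def
proof (intro allI impI)
  fix \<phi> :: "_ \<Rightarrow> 'a" assume \<phi>: "\<forall>e\<in>insert (r0, c0) F. \<phi> e \<noteq> 0"
  then have "\<forall>e\<in>F. \<phi> e \<noteq> 0" by simp
  then obtain x y where x: "\<And>r. x r \<noteq> 0" and y: "\<And>c. y c \<noteq> 0"
    and xy: "\<And>r c. (r, c) \<in> F \<Longrightarrow> x r * y c = \<phi> (r, c)"
    using free unfolding torus_free_def by blast
  define s where "s = \<phi> (r0, c0) / (x r0 * y c0)"
  have s: "s \<noteq> 0" using \<phi> x y by (simp add: s_def)
  define t where "t = (if r0 \<in> R then s else 1 / s)"
  have t: "t \<noteq> 0" using s by (simp add: t_def)
  define x' where "x' r = (if r \<in> R then x r * t else x r)" for r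
  define y' where "y' c = (if c \<in> C then y c / t else y c)" for c
  have "x' r * y' c = \<phi> (r, c)" if "(r, c) \<in> F" for r c
    using F[OF that] xy[OF that] t by (auto simp: x'_def y'_def)
  moreover have "x' r0 * y' c0 = \<phi> (r0, c0)"
    using e x y s by (auto simp: x'_def y'_def t_def) (auto simp: s_def)
  ultimately show "\<exists>x y. (\<forall>r. x r \<noteq> 0) \<and> (\<forall>c. y c \<noteq> 0) \<and>
      (\<forall>r c. (r, c) \<in> insert (r0, c0) F \<longrightarrow> x r * y c = \<phi> (r, c))"
    using x y t by (intro exI[of _ x'] exI[of _ y']) (auto simp: x'_def y'_def)
qed

text \<open>The row \<open>r0\<close> is not met by \<open>F\<close>, so that vertex alone is a cut
  crossed only by the new edge.\<close>

lemma torus_free_insert_row: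
  assumes "torus_free TYPE('a::field) F" "r0 \<notin> fst ` F"
  shows "torus_free TYPE('a) (insert (r0, c0) F)"
  by (rule torus_free_insert[where R = "{r0}" and C = "{}"]) (use assms in force)+

lemma torus_free_insert_col:
  assumes "torus_free TYPE('a::field) F" "c0 \<notin> snd ` F"
  shows "torus_free TYPE('a) (insert (r0, c0) F)"
  by (rule torus_free_insert[where R = "{}" and C = "{c0}"]) (use assms in force)+

text \<open>Each edge of \<open>\<mu>\<close> brings a row met neither by \<open>F\<close> nor by
  the edges added before it.\<close>

lemma torus_free_Un_rook_placement:
  assumes "rook_placement \<mu>" "torus_free TYPE('a::field) F" "fst ` \<mu> \<inter> fst ` F = {}"
  shows "torus_free TYPE('a) (F \<union> \<mu>)"
  using assms(1,3)
proof (induction rule: rook_placement_induct)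
  case empty
  show ?case using assms(2) by simp
next
  case (insert i j \<mu>)
  have "torus_free TYPE('a) (insert (i, j) (F \<union> \<mu>))"
    by (rule torus_free_insert_row) (use insert in auto)
  then show ?case by simp
qed

section \<open>Supports formed by a prescribed part and isolated edges\<close>

text \<open>As a graph, \<open>\<sigma>\<close> is the disjoint union of \<open>\<tau>\<close>, of \<open>i\<close> copies of \<open>EG\<close>, and of isolated vertices.\<close>

definition placement_with :: "('r \<times> 'c) set \<Rightarrow> nat \<Rightarrow> ('r \<times> 'c) set \<Rightarrow> bool" where
  "placement_with \<tau> i \<sigma> \<longleftrightarrow> (\<exists>\<mu>. rook_placement \<mu> \<and> card \<mu> = i \<and>
     fst ` \<mu> \<inter> fst ` \<tau> = {} \<and> snd ` \<mu> \<inter> snd ` \<tau> = {} \<and> \<sigma> = \<tau> \<union> \<mu>)"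

lemma placement_with_finite: "placement_with \<tau> i \<sigma> \<Longrightarrow> finite \<tau> \<Longrightarrow> finite \<sigma>"
  by (auto simp: placement_with_def rook_placement_def)

lemma placement_with_subset: "placement_with \<tau> i \<sigma> \<Longrightarrow> \<tau> \<subseteq> \<sigma>"
  by (auto simp: placement_with_def)

lemma placement_with_card:
  assumes "placement_with \<tau> i \<sigma>" "finite \<tau>"
  shows "card \<sigma> = card \<tau> + i" "card (fst ` \<sigma>) = card (fst ` \<tau>) + i" "card (snd ` \<sigma>) = card (snd ` \<tau>) + i"
proof -
  obtain \<mu> where \<mu>: "rook_placement \<mu>" "card \<mu> = i" "fst ` \<mu> \<inter> fst ` \<tau> = {}" "snd ` \<mu> \<inter> snd ` \<tau> = {}"
    "\<sigma> = \<tau> \<union> \<mu>" using assms(1) by (auto simp: placement_with_def)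
  have fin: "finite \<mu>" using \<mu>(1) by (simp add: rook_placement_def)
  have "\<tau> \<inter> \<mu> = {}" using \<mu>(3) by force
  then show "card \<sigma> = card \<tau> + i" using assms(2) fin \<mu> by (simp add: card_Un_disjoint)
  show "card (fst ` \<sigma>) = card (fst ` \<tau>) + i" "card (snd ` \<sigma>) = card (snd ` \<tau>) + i"
    unfolding \<mu>(5) image_Un using assms(2) fin \<mu> card_rook_placement[OF \<mu>(1)]
    by (auto simp: card_Un_disjoint Int_commute)
qed

lemma placement_with_torus_free:
  assumes "placement_with \<tau> i \<sigma>" "torus_free TYPE('a::field) \<tau>"
  shows "torus_free TYPE('a) \<sigma>"
  using assms torus_free_Un_rook_placement unfolding placement_with_def by blast

text \<open>Pivot rows allow the columns of \<open>\<mu>\<close> to be added to \<open>J\<close>,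
  which bounds the rank from below. From above, a rook placement has at most as many cells as
  \<open>\<sigma>\<close> has rows, and at most as many as it has columns; by the last condition on
  \<open>J\<close> one of these numbers is \<open>card J + i\<close>.\<close>

lemma placement_with_has_rank:
  assumes \<sigma>: "placement_with \<tau> i \<sigma>" and fin: "finite \<tau>" and f: "fun_supp f = \<sigma>"
    and J: "col_indep f J" "J \<subseteq> snd ` \<tau>" "card J = card (fst ` \<tau>) \<or> card J = card (snd ` \<tau>)"
  shows "has_rank f (card J + i)"
proof -
  obtain \<mu> where \<mu>: "rook_placement \<mu>" "card \<mu> = i" "fst ` \<mu> \<inter> fst ` \<tau> = {}" "snd ` \<mu> \<inter> snd ` \<tau> = {}"
    "\<sigma> = \<tau> \<union> \<mu>" using \<sigma> by (auto simp: placement_with_def)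
  have finm: "finite \<mu>" using \<mu>(1) by (simp add: rook_placement_def)
  have ind: "col_indep f (snd ` \<mu> \<union> J)"
  proof (rule col_indep_Un_rook_placement[OF \<mu>(1) J(1)])
    show "\<mu> \<subseteq> fun_supp f" using f \<mu> by blast
    show "snd ` \<mu> \<inter> J = {}" using \<mu>(4) J(2) by blast
    fix r c assume "r \<in> fst ` \<mu>" "f (r, c) \<noteq> 0"
    then have "(r, c) \<in> \<tau> \<union> \<mu>" "r \<notin> fst ` \<tau>" using f \<mu>(3,5) by (auto simp: fun_supp_def)
    then show "(r, c) \<in> \<mu>" by force
  qed
  have finJ: "finite J" using J(1) by (simp add: col_indep_def)
  show ?thesis
  proof (rule has_rankI)
    show "finite (fun_supp f)" using \<mu> f fin finm by simp
    show "col_indep f (snd ` \<mu> \<union> J)" by (rule ind)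
    show "card (snd ` \<mu> \<union> J) = card J + i"
      using \<mu>(2,4) J(2) finJ finm card_rook_placement[OF \<mu>(1)] by (subst card_Un_disjoint) auto
    fix \<nu> assume \<nu>: "\<nu> \<subseteq> fun_supp f" "rook_placement \<nu>"
    have "finite \<sigma>" using \<mu>(5) fin finm by simp
    then have "card (fst ` \<nu>) \<le> card (fst ` \<sigma>)" "card (snd ` \<nu>) \<le> card (snd ` \<sigma>)"
      using \<nu>(1) f by (auto intro!: card_mono)
    then show "card \<nu> \<le> card J + i"
      using placement_with_card[OF \<sigma> fin] card_rook_placement[OF \<nu>(2)] J(3) by auto
  qed
qed

text \<open>With \<open>F = \<sigma>\<close> the only normalised function is the indicator function
  of \<open>\<sigma>\<close>.\<close>

lemma card_supp_rank_funs_forest: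
  fixes \<sigma> :: "('r \<times> 'c) set"
  assumes "torus_free TYPE('a::{field,finite}) \<sigma>" "finite \<sigma>"
    and rank: "\<And>f :: 'r \<times> 'c \<Rightarrow> 'a. fun_supp f = \<sigma> \<Longrightarrow> has_rank f d"
  shows "card (supp_rank_funs \<sigma> d :: ('r \<times> 'c \<Rightarrow> 'a) set) = (CARD('a) - 1) ^ card \<sigma>"
proof -
  let ?g = "\<lambda>e. if e \<in> \<sigma> then 1 else 0 :: 'a"
  have "{f :: 'r \<times> 'c \<Rightarrow> 'a. f \<in> supp_rank_funs \<sigma> d \<and> (\<forall>e\<in>\<sigma>. f e = 1)} = {?g}"
    (is "?L = _")
  proof
    show "?L \<subseteq> {?g}"
    proof
      fix f assume "f \<in> ?L"
      then have "fun_supp f = \<sigma>" "\<forall>e\<in>\<sigma>. f e = 1" by (auto simp: supp_rank_funs_def)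
      then have "f e = ?g e" for e by (auto simp: fun_supp_def)
      then show "f \<in> {?g}" by (simp add: fun_eq_iff)
    qed
    have "fun_supp ?g = \<sigma>" by (auto simp: fun_supp_def)
    then show "{?g} \<subseteq> ?L" using rank by (simp add: supp_rank_funs_def)
  qed
  then show ?thesis using card_supp_rank_funs[OF assms(1) order_refl assms(2), of d] by simp
qed

section \<open>The exceptional supports\<close>

text \<open>The four shapes are given by cells with named vertices, so that ranks can be computed
  directly on arrays; the link with \<open>bigraph_iso\<close> is established separately.\<close>

definition ZG_placement :: "nat \<Rightarrow> ('r \<times> 'c) set \<Rightarrow> bool" where
  "ZG_placement i \<sigma> \<longleftrightarrow> (\<exists>r1 r2 c1 c2. r1 \<noteq> r2 \<and> c1 \<noteq> c2 \<and>
     placement_with {(r1, c1), (r1, c2), (r2, c2)} i \<sigma>)"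

definition SG_placement :: "nat \<Rightarrow> ('r \<times> 'c) set \<Rightarrow> bool" where
  "SG_placement i \<sigma> \<longleftrightarrow> (\<exists>r1 r2 c1 c2. r1 \<noteq> r2 \<and> c1 \<noteq> c2 \<and>
     placement_with {(r1, c1), (r1, c2), (r2, c1), (r2, c2)} i \<sigma>)"

definition WRG_placement :: "nat \<Rightarrow> ('r \<times> 'c) set \<Rightarrow> bool" where
  "WRG_placement i \<sigma> \<longleftrightarrow> (\<exists>r1 r2 c. r1 \<noteq> r2 \<and> placement_with {(r1, c), (r2, c)} i \<sigma>)"

definition WCG_placement :: "nat \<Rightarrow> ('r \<times> 'c) set \<Rightarrow> bool" where
  "WCG_placement i \<sigma> \<longleftrightarrow> (\<exists>r c1 c2. c1 \<noteq> c2 \<and> placement_with {(r, c1), (r, c2)} i \<sigma>)"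

text \<open>The numbers of cells, occupied rows and occupied columns together tell the types of
  support apart; this lemma and the next three record them.\<close>

lemma ZG_placement_card:
  assumes "ZG_placement i \<sigma>"
  shows "card \<sigma> = i + 3 \<and> card (fst ` \<sigma>) = i + 2 \<and> card (snd ` \<sigma>) = i + 2"
proof -
  obtain r1 r2 c1 c2 where *: "r1 \<noteq> r2" "c1 \<noteq> c2" "placement_with {(r1, c1), (r1, c2), (r2, c2)} i \<sigma>"
    using assms by (auto simp: ZG_placement_def)
  show ?thesis using placement_with_card[OF *(3)] *(1,2) by simp
qed

lemma SG_placement_card:
  assumes "SG_placement i \<sigma>"
  shows "card \<sigma> = i + 4 \<and> card (fst ` \<sigma>) = i + 2 \<and> card (snd ` \<sigma>) = i + 2"
proof -
  obtain r1 r2 c1 c2 where *: "r1 \<noteq> r2" "c1 \<noteq> c2"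
    "placement_with {(r1, c1), (r1, c2), (r2, c1), (r2, c2)} i \<sigma>"
    using assms by (auto simp: SG_placement_def)
  have "{c1, c2, c1, c2} = {c1, c2}" by auto
  then show ?thesis using placement_with_card[OF *(3)] *(1,2) by simp
qed

lemma WRG_placement_card:
  assumes "WRG_placement i \<sigma>"
  shows "card \<sigma> = i + 2 \<and> card (fst ` \<sigma>) = i + 2 \<and> card (snd ` \<sigma>) = i + 1"
proof -
  obtain r1 r2 c where *: "r1 \<noteq> r2" "placement_with {(r1, c), (r2, c)} i \<sigma>"
    using assms by (auto simp: WRG_placement_def)
  show ?thesis using placement_with_card[OF *(2)] *(1) by simp
qed

lemma WCG_placement_card:
  assumes "WCG_placement i \<sigma>"
  shows "card \<sigma> = i + 2 \<and> card (fst ` \<sigma>) = i + 1 \<and> card (snd ` \<sigma>) = i + 2"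
proof -
  obtain r c1 c2 where *: "c1 \<noteq> c2" "placement_with {(r, c1), (r, c2)} i \<sigma>"
    using assms by (auto simp: WCG_placement_def)
  show ?thesis using placement_with_card[OF *(2)] *(1) by simp
qed

lemma placement_with_fun_supp_iff:
  assumes "placement_with \<tau> i \<sigma>" "fun_supp f = \<sigma>" "r \<in> fst ` \<tau> \<or> c \<in> snd ` \<tau>"
  shows "f (r, c) \<noteq> 0 \<longleftrightarrow> (r, c) \<in> \<tau>"
proof -
  obtain \<mu> where \<mu>: "fst ` \<mu> \<inter> fst ` \<tau> = {}" "snd ` \<mu> \<inter> snd ` \<tau> = {}" "\<sigma> = \<tau> \<union> \<mu>"
    using assms(1) by (auto simp: placement_with_def)
  have "(r, c) \<notin> \<mu>"
  proof
    assume "(r, c) \<in> \<mu>"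
    then have "r \<in> fst ` \<mu>" "c \<in> snd ` \<mu>" by force+
    then show False using \<mu>(1,2) assms(3) by blast
  qed
  moreover have "f (r, c) \<noteq> 0 \<longleftrightarrow> (r, c) \<in> \<sigma>" using assms(2) by (auto simp: fun_supp_def)
  ultimately show ?thesis using \<mu>(3) by simp
qed

section \<open>Numbers of functions on rook placements and on the four shapes\<close>

lemma rook_placement_has_rank:
  assumes "rook_placement \<sigma>" "fun_supp f = \<sigma>"
  shows "has_rank f (card \<sigma>)"
proof -
  have "placement_with {} (card \<sigma>) \<sigma>" using assms(1) by (auto simp: placement_with_def)
  from placement_with_has_rank[OF this _ assms(2) col_indep_empty] show ?thesis by simp
qed

lemma rook_placement_torus_free:
  assumes "rook_placement \<mu>"
  shows "torus_free TYPE('a::field) \<mu>"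
  using torus_free_Un_rook_placement[OF assms torus_free_empty] by simp

lemma card_rook_placement_funs:
  assumes "rook_placement (\<sigma> :: ('r \<times> 'c) set)"
  shows "card (supp_rank_funs \<sigma> (card \<sigma>) :: ('r \<times> 'c \<Rightarrow> 'a::{field,finite}) set) = (CARD('a) - 1) ^ card \<sigma>"
  by (rule card_supp_rank_funs_forest[OF rook_placement_torus_free[OF assms]])
    (use assms rook_placement_has_rank[OF assms] in \<open>auto simp: rook_placement_def\<close>)

text \<open>The path is free because it arises by attaching one edge after another at a new vertex.
  Row \<open>r1\<close> is a pivot for \<open>c1\<close>, and row \<open>r2\<close>, where column
  \<open>c1\<close> vanishes, is one for \<open>c2\<close>; so the rank is always
  \<open>i + 2\<close>, while there are \<open>i + 3\<close> edges.\<close>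

lemma card_ZG_placement_funs:
  assumes "ZG_placement i (\<sigma> :: ('r \<times> 'c) set)"
  shows "card (supp_rank_funs \<sigma> (i + 2) :: ('r \<times> 'c \<Rightarrow> 'a::{field,finite}) set) = (CARD('a) - 1) ^ (i + 3)"
proof -
  obtain r1 r2 c1 c2 where ne: "r1 \<noteq> r2" "c1 \<noteq> c2"
    and p: "placement_with {(r1, c1), (r1, c2), (r2, c2)} i \<sigma>" (is "placement_with ?\<tau> i \<sigma>")
    using assms by (auto simp: ZG_placement_def)
  have "torus_free TYPE('a) {(r2, c2)}" by (rule torus_free_insert_row) auto
  then have "torus_free TYPE('a) {(r1, c2), (r2, c2)}"
    by (rule torus_free_insert_row) (use ne in auto)
  then have "torus_free TYPE('a) ?\<tau>" by (rule torus_free_insert_col) (use ne in auto)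
  then have free: "torus_free TYPE('a) \<sigma>" by (rule placement_with_torus_free[OF p])
  have "has_rank f (i + 2)" if f: "fun_supp f = \<sigma>" for f :: "'r \<times> 'c \<Rightarrow> 'a"
  proof -
    note nz = placement_with_fun_supp_iff[OF p f]
    have "col_indep f {c1}" by (rule col_indep_insert[of _ _ r1]) (use nz[of r1 c1] in auto)
    then have "col_indep f {c2, c1}"
      by (rule col_indep_insert[of _ _ r2]) (use nz[of r2 c2] nz[of r2 c1] ne in auto)
    from placement_with_has_rank[OF p _ f this] show ?thesis using ne by simp
  qed
  from card_supp_rank_funs_forest[OF free placement_with_finite[OF p] this] show ?thesis
    using ZG_placement_card[OF assms] by simp
qed

text \<open>\<open>?\<tau>\<close> has a single column, and a nonzero column is independent, so the
  rank is \<open>i + 1\<close>; the additional edge contributes one more factor.\<close>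

lemma card_WRG_placement_funs:
  assumes "WRG_placement i (\<sigma> :: ('r \<times> 'c) set)"
  shows "card (supp_rank_funs \<sigma> (i + 1) :: ('r \<times> 'c \<Rightarrow> 'a::{field,finite}) set) = (CARD('a) - 1) ^ (i + 2)"
proof -
  obtain r1 r2 c where ne: "r1 \<noteq> r2"
    and p: "placement_with {(r1, c), (r2, c)} i \<sigma>" (is "placement_with ?\<tau> i \<sigma>")
    using assms by (auto simp: WRG_placement_def)
  have "torus_free TYPE('a) {(r2, c)}" by (rule torus_free_insert_row) auto
  then have "torus_free TYPE('a) ?\<tau>" by (rule torus_free_insert_row) (use ne in auto)
  then have free: "torus_free TYPE('a) \<sigma>" by (rule placement_with_torus_free[OF p])
  have "has_rank f (i + 1)" if f: "fun_supp f = \<sigma>" for f :: "'r \<times> 'c \<Rightarrow> 'a"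
  proof -
    note nz = placement_with_fun_supp_iff[OF p f]
    have "col_indep f {c}" by (rule col_indep_insert[of _ _ r1]) (use nz[of r1 c] in auto)
    from placement_with_has_rank[OF p _ f this] show ?thesis using ne by simp
  qed
  from card_supp_rank_funs_forest[OF free placement_with_finite[OF p] this] show ?thesis
    using WRG_placement_card[OF assms] by simp
qed

text \<open>Here \<open>?\<tau>\<close> has two columns but a single row, and it is the row count
  that bounds the rank by \<open>i + 1\<close>.\<close>

lemma card_WCG_placement_funs:
  assumes "WCG_placement i (\<sigma> :: ('r \<times> 'c) set)"
  shows "card (supp_rank_funs \<sigma> (i + 1) :: ('r \<times> 'c \<Rightarrow> 'a::{field,finite}) set) = (CARD('a) - 1) ^ (i + 2)"
proof -
  obtain r c1 c2 where ne: "c1 \<noteq> c2"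
    and p: "placement_with {(r, c1), (r, c2)} i \<sigma>" (is "placement_with ?\<tau> i \<sigma>")
    using assms by (auto simp: WCG_placement_def)
  have "torus_free TYPE('a) {(r, c2)}" by (rule torus_free_insert_row) auto
  then have "torus_free TYPE('a) ?\<tau>" by (rule torus_free_insert_col) (use ne in auto)
  then have free: "torus_free TYPE('a) \<sigma>" by (rule placement_with_torus_free[OF p])
  have "has_rank f (i + 1)" if f: "fun_supp f = \<sigma>" for f :: "'r \<times> 'c \<Rightarrow> 'a"
  proof -
    note nz = placement_with_fun_supp_iff[OF p f]
    have "col_indep f {c1}" by (rule col_indep_insert[of _ _ r]) (use nz[of r c1] in auto)
    from placement_with_has_rank[OF p _ f this] show ?thesis using ne by simp
  qed
  from card_supp_rank_funs_forest[OF free placement_with_finite[OF p] this] show ?thesis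
    using WCG_placement_card[OF assms] by simp
qed

text \<open>Omitting the cell \<open>(r2, c2)\<close> opens the square to a path. Once all other
  entries are normalised to 1, only the value \<open>t\<close> at this cell is left: the support
  demands that it differ from 0, the rank that it differ from 1.\<close>

lemma card_SG_placement_funs:
  assumes "SG_placement i (\<sigma> :: ('r \<times> 'c) set)"
  shows "card (supp_rank_funs \<sigma> (i + 2) :: ('r \<times> 'c \<Rightarrow> 'a::{field,finite}) set) =
    (CARD('a) - 1) ^ (i + 3) * (CARD('a) - 2)"
proof -
  obtain r1 r2 c1 c2 where ne: "r1 \<noteq> r2" "c1 \<noteq> c2"
    and p: "placement_with {(r1, c1), (r1, c2), (r2, c1), (r2, c2)} i \<sigma>" (is "placement_with ?\<tau> i \<sigma>")
    using assms by (auto simp: SG_placement_def)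
  let ?\<tau>' = "{(r1, c1), (r1, c2), (r2, c1)}"
  define F where "F = \<sigma> - {(r2, c2)}"
  have pF: "placement_with ?\<tau>' i F"
  proof -
    obtain \<mu> where \<mu>: "rook_placement \<mu>" "card \<mu> = i" "fst ` \<mu> \<inter> {r1, r2} = {}" "snd ` \<mu> \<inter> {c1, c2} = {}"
      "\<sigma> = ?\<tau> \<union> \<mu>"
      using p by (auto simp: placement_with_def)
    have "(r2, c2) \<notin> \<mu>" using \<mu>(3) by force
    then have "F = ?\<tau>' \<union> \<mu>" using \<mu>(5) ne by (auto simp: F_def)
    then show ?thesis unfolding placement_with_def using \<mu>(1-4) by (intro exI[of _ \<mu>]) auto
  qed
  have "torus_free TYPE('a) {(r2, c1)}" by (rule torus_free_insert_row) auto
  then have "torus_free TYPE('a) {(r1, c2), (r2, c1)}"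
    by (rule torus_free_insert_row) (use ne in auto)
  \<comment> \<open>Both ends of \<open>(r1, c1)\<close> are already in use; the cut is the vertex
    set of the edge \<open>(r1, c2)\<close>.\<close>
  then have "torus_free TYPE('a) ?\<tau>'"
    by (rule torus_free_insert[where R = "{r1}" and C = "{c2}"]) (use ne in auto)
  then have free: "torus_free TYPE('a) F" by (rule placement_with_torus_free[OF pF])
  have finF: "finite F" using placement_with_finite[OF pF] by simp
  have cF: "card F = i + 3" using placement_with_card(1)[OF pF] ne by simp
  have e\<sigma>: "(r2, c2) \<in> \<sigma>" "?\<tau>' \<subseteq> F" using placement_with_subset[OF p] ne by (auto simp: F_def)
  define g :: "'a \<Rightarrow> 'r \<times> 'c \<Rightarrow> 'a" where
    "g t e = (if e = (r2, c2) then t else if e \<in> F then 1 else 0)" for t e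
  have gs: "fun_supp (g t) = \<sigma>" if "t \<noteq> 0" for t
    using that e\<sigma> by (auto simp: fun_supp_def g_def F_def)
  have val: "g t (r1, c1) = 1" "g t (r1, c2) = 1" "g t (r2, c1) = 1" "g t (r2, c2) = t" for t
    using e\<sigma>(2) ne by (auto simp: g_def)
  have rank: "has_rank (g t) (i + 2)" if t: "t \<noteq> 0" "t \<noteq> 1" for t
  proof -
    have "col_indep (g t) {c1, c2}"
      unfolding col_indep_def
    proof (intro conjI allI impI)
      fix a assume a: "\<forall>r. (\<Sum>c\<in>{c1, c2}. a c * g t (r, c)) = 0"
      have 1: "a c1 + a c2 = 0" using a[rule_format, of r1] ne val by simp
      have 2: "a c1 + a c2 * t = 0" using a[rule_format, of r2] ne val by simp
      \<comment> \<open>Row \<open>r2\<close> minus row \<open>r1\<close> eliminates the coefficient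
        of \<open>c1\<close>.\<close>
      have "a c2 * (t - 1) = (a c1 + a c2 * t) - (a c1 + a c2)" by (simp add: algebra_simps)
      then have "a c2 = 0" using t 1 2 by simp
      then show "\<forall>c\<in>{c1, c2}. a c = 0" using 1 by simp
    qed simp
    from placement_with_has_rank[OF p _ gs[OF t(1)] this] show ?thesis using ne by simp
  qed
  \<comment> \<open>For \<open>t = 1\<close> the columns \<open>c1\<close> and \<open>c2\<close> of
    \<open>g t\<close> coincide, yet rank \<open>i + 2\<close> would require all
    \<open>i + 2\<close> columns of the support to be independent.\<close>
  have norank: "\<not> has_rank (g 1) (i + 2)"
  proof
    assume "has_rank (g 1) (i + 2)"
    then obtain J where J: "col_indep (g 1) J" "card J = i + 2" by (auto simp: has_rank_def)
    have fin: "finite \<sigma>" using finF by (simp add: F_def)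
    obtain \<mu> where "\<mu> \<subseteq> \<sigma>" "snd ` \<mu> = J"
      using col_indep_rook_placement[OF J(1)] gs[of 1] fin by auto
    then have "J \<subseteq> snd ` \<sigma>" by auto
    then have "J = snd ` \<sigma>"
      using J(2) SG_placement_card[OF assms] fin by (intro card_subset_eq) auto
    then have cJ: "c1 \<in> J" "c2 \<in> J" using placement_with_subset[OF p] by force+
    have finJ: "finite J" using J(1) by (simp add: col_indep_def)
    define a :: "'c \<Rightarrow> 'a" where "a c = (if c = c1 then 1 else if c = c2 then -1 else 0)" for c
    have "(\<Sum>c\<in>J. a c * g 1 (r, c)) = 0" for r
    proof -
      have "(\<Sum>c\<in>J. a c * g 1 (r, c)) = (\<Sum>c\<in>{c1, c2}. a c * g 1 (r, c))"
        using finJ cJ by (intro sum.mono_neutral_right) (auto simp: a_def)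
      also have "\<dots> = g 1 (r, c1) - g 1 (r, c2)" using ne by (simp add: a_def)
      \<comment> \<open>In the rows \<open>r1\<close> and \<open>r2\<close> both entries are 1; in
        every other row both are 0.\<close>
      also have "\<dots> = 0"
        using placement_with_fun_supp_iff[OF p gs, of 1 r c1] placement_with_fun_supp_iff[OF p gs, of 1 r c2]
          val[of 1] by (cases "r = r1"; cases "r = r2") auto
      finally show ?thesis .
    qed
    then have "a c1 = 0" by (rule col_indepD[OF J(1)]) (rule cJ)
    then show False by (simp add: a_def)
  qed
  let ?S1 = "{f :: 'r \<times> 'c \<Rightarrow> 'a. f \<in> supp_rank_funs \<sigma> (i + 2) \<and> (\<forall>e\<in>F. f e = 1)}"
  have "?S1 = g ` (UNIV - {0, 1})"
  proof
    show "g ` (UNIV - {0, 1}) \<subseteq> ?S1"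
    proof
      fix f assume "f \<in> g ` (UNIV - {0, 1})"
      then obtain t where t: "f = g t" "t \<noteq> 0" "t \<noteq> 1" by auto
      have "\<forall>e\<in>F. g t e = 1" by (auto simp: g_def F_def)
      then show "f \<in> ?S1" using gs[OF t(2)] rank[OF t(2,3)] t(1) by (simp add: supp_rank_funs_def)
    qed
    show "?S1 \<subseteq> g ` (UNIV - {0, 1})"
    proof
      fix f assume "f \<in> ?S1"
      then have f: "fun_supp f = \<sigma>" "has_rank f (i + 2)" "\<forall>e\<in>F. f e = 1"
        by (auto simp: supp_rank_funs_def)
      define t where "t = f (r2, c2)"
      have "f e = g t e" for e
        using f(1,3) by (auto simp: g_def t_def F_def fun_supp_def)
      then have fg: "f = g t" by auto
      moreover have "t \<noteq> 0" using f(1) e\<sigma>(1) by (auto simp: t_def fun_supp_def)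
      moreover have "t \<noteq> 1" using f(2) norank fg by auto
      ultimately show "f \<in> g ` (UNIV - {0, 1})" by blast
    qed
  qed
  moreover have "inj g" using val(4) by (intro injI) metis
  then have "card (g ` (UNIV - {0, 1})) = card (UNIV - {0, 1 :: 'a})"
    by (intro card_image) (auto intro: inj_on_subset)
  then have "card (g ` (UNIV - {0, 1})) = CARD('a) - 2" by (simp add: card_Diff_subset)
  ultimately show ?thesis
    using card_supp_rank_funs[OF free _ finF, of \<sigma> "i + 2"] cF by (simp add: F_def)
qed

section \<open>Supports that contain a rook placement\<close>

text \<open>The configuration excluded by \<open>n\<close> is exactly the one in which two distinct
  extra edges become parallel when \<open>\<mu>\<close> is contracted. Otherwise some component of
  \<open>\<mu>\<close> gives a cut that separates the ends of the second edge and is not crossed by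
  the first.\<close>

lemma torus_free_two_extra_edges:
  assumes \<mu>: "rook_placement \<mu>" and e: "(r, c) \<notin> \<mu>" and e': "(r', c') \<notin> \<mu>" "(r, c) \<noteq> (r', c')"
    and n: "\<not> ((r, c') \<in> \<mu> \<and> (r', c) \<in> \<mu>)"
  shows "torus_free TYPE('a::field) (insert (r', c') (insert (r, c) \<mu>))"
proof -
  \<comment> \<open>The component of row \<open>i\<close> in \<open>\<mu>\<close>, which has at most
    one column, is a cut crossed by no edge of \<open>\<mu>\<close>; \<open>col\<close> is the same
    for a column.\<close>
  have row: "x \<in> {i} \<longleftrightarrow> y \<in> {j. (i, j) \<in> \<mu>}" if "(x, y) \<in> \<mu>" for x y i
    using that rook_placementD[OF \<mu>] by blast
  have col: "x \<in> {i. (i, j) \<in> \<mu>} \<longleftrightarrow> y \<in> {j}" if "(x, y) \<in> \<mu>" for x y j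
    using that rook_placementD[OF \<mu>] by blast
  have free: "torus_free TYPE('a) (insert (r, c) \<mu>)"
    by (rule torus_free_insert[OF rook_placement_torus_free[OF \<mu>] row[of _ _ r]]) (use e in auto)
  show ?thesis
  \<comment> \<open>The condition says that \<open>(r, c)\<close> does not cross the component of
    row \<open>r'\<close>. If it does, the component of column \<open>c'\<close> is used instead; by
    \<open>n\<close> and the distinctness of the edges, neither end of \<open>(r, c)\<close> lies in
    it.\<close>
  proof (cases "r = r' \<longleftrightarrow> (r', c) \<in> \<mu>")
    case True
    have R: "x \<in> {r'} \<longleftrightarrow> y \<in> {j. (r', j) \<in> \<mu>}" if "(x, y) \<in> insert (r, c) \<mu>" for x y
      using that row[of x y r'] True by auto
    show ?thesis by (rule torus_free_insert[OF free R]) (use e' in auto)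
  next
    case False
    have R: "x \<in> {i. (i, c') \<in> \<mu>} \<longleftrightarrow> y \<in> {c'}" if "(x, y) \<in> insert (r, c) \<mu>" for x y
      using that col[of x y c'] False n e e' by auto
    show ?thesis by (rule torus_free_insert[OF free R]) (use e' in auto)
  qed
qed

text \<open>\<open>\<rho>\<close> collects the edges of \<open>\<mu>\<close> absorbed into
  \<open>\<tau>\<close>; those in \<open>\<mu> - \<rho>\<close> remain as isolated edges.\<close>

lemma placement_with_remove:
  assumes \<mu>: "rook_placement \<mu>" and \<rho>: "\<rho> \<subseteq> \<mu>" and i: "card \<mu> = i + card \<rho>"
    and r: "\<And>r c. (r, c) \<in> \<mu> - \<rho> \<Longrightarrow> r \<notin> fst ` \<tau>"
    and c: "\<And>r c. (r, c) \<in> \<mu> - \<rho> \<Longrightarrow> c \<notin> snd ` \<tau>"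
    and \<sigma>: "\<sigma> = \<tau> \<union> \<mu>" and "\<rho> \<subseteq> \<tau>"
  shows "placement_with \<tau> i \<sigma>"
  unfolding placement_with_def
proof (intro exI[of _ "\<mu> - \<rho>"] conjI)
  show "rook_placement (\<mu> - \<rho>)" by (rule rook_placement_subset[OF \<mu>]) auto
  have "finite \<rho>" using \<mu> \<rho> finite_subset by (auto simp: rook_placement_def)
  then show "card (\<mu> - \<rho>) = i" using i \<rho> by (simp add: card_Diff_subset)
  show "fst ` (\<mu> - \<rho>) \<inter> fst ` \<tau> = {}"
  proof (rule ccontr)
    assume "\<not> ?thesis"
    then obtain x where "x \<in> \<mu> - \<rho>" "fst x \<in> fst ` \<tau>" by auto
    then show False using r[of "fst x" "snd x"] by simp
  qed
  show "snd ` (\<mu> - \<rho>) \<inter> snd ` \<tau> = {}"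
  proof (rule ccontr)
    assume "\<not> ?thesis"
    then obtain x where "x \<in> \<mu> - \<rho>" "snd x \<in> snd ` \<tau>" by auto
    then show False using c[of "fst x" "snd x"] by simp
  qed
  show "\<sigma> = \<tau> \<union> (\<mu> - \<rho>)" using \<sigma> \<open>\<rho> \<subseteq> \<tau>\<close> by auto
qed

text \<open>Two extra edges that do not form a square with two edges of \<open>\<mu>\<close> would
  give a free set with \<open>card \<mu> + 2\<close> edges. This leaves at most two extra edges, and
  two of them form \<open>SG\<close>.\<close>

lemma rook_placement_extension_cases:
  fixes \<mu> \<sigma> :: "('r \<times> 'c) set"
  assumes \<mu>: "rook_placement \<mu>" and sub: "\<mu> \<subseteq> \<sigma>" and fin: "finite \<sigma>"
    and nofree: "\<And>F. F \<subseteq> \<sigma> \<Longrightarrow> torus_free TYPE('a::field) F \<Longrightarrow> card F \<noteq> card \<mu> + 2"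
  obtains "rook_placement \<sigma>"
  | i where "card \<mu> = i + 2" "ZG_placement i \<sigma>"
  | i where "card \<mu> = i + 2" "SG_placement i \<sigma>"
  | i where "card \<mu> = i + 1" "WRG_placement i \<sigma>"
  | i where "card \<mu> = i + 1" "WCG_placement i \<sigma>"
proof (cases "\<sigma> = \<mu>")
  case True
  then show ?thesis using that(1) \<mu> by simp
next
  case False
  have fm: "finite \<mu>" using \<mu> by (simp add: rook_placement_def)
  note D = rook_placementD[OF \<mu>]
  have sq: "(r, c') \<in> \<mu> \<and> (r', c) \<in> \<mu>"
    if "(r, c) \<in> \<sigma> - \<mu>" "(r', c') \<in> \<sigma> - \<mu>" "(r, c) \<noteq> (r', c')" for r c r' c'
  proof (rule ccontr)
    assume n: "\<not> ?thesis"
    have "torus_free TYPE('a) (insert (r', c') (insert (r, c) \<mu>))"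
      by (rule torus_free_two_extra_edges[OF \<mu> _ _ _ n]) (use that in auto)
    then have "card (insert (r', c') (insert (r, c) \<mu>)) \<noteq> card \<mu> + 2"
      by (rule nofree[rotated]) (use that sub in auto)
    moreover have "(r', c') \<notin> insert (r, c) \<mu>" "(r, c) \<notin> \<mu>" using that by auto
    ultimately show False using fm by simp
  qed
  obtain r c where e: "(r, c) \<in> \<sigma> - \<mu>" using False sub by auto
  show ?thesis
  proof (cases "\<sigma> = insert (r, c) \<mu>")
    case \<sigma>: True
    show ?thesis
    \<comment> \<open>For a single extra edge, both ends met by \<open>\<mu>\<close> give
      \<open>ZG\<close>, only the row gives \<open>WCG\<close>, only the column gives
      \<open>WRG\<close>, and neither gives a larger rook placement.\<close>
    proof (cases "r \<in> fst ` \<mu>"; cases "c \<in> snd ` \<mu>")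
      assume "r \<in> fst ` \<mu>" "c \<in> snd ` \<mu>"
      then obtain r1 c1 where rc: "(r, c1) \<in> \<mu>" "(r1, c) \<in> \<mu>" by auto
      have ne: "r \<noteq> r1" "c1 \<noteq> c" using rc e by auto
      have "{(r, c1), (r1, c)} \<subseteq> \<mu>" using rc by simp
      then have "2 \<le> card \<mu>" using card_mono[OF fm, of "{(r, c1), (r1, c)}"] ne by simp
      then obtain i where i: "card \<mu> = i + 2" by (metis add.commute le_Suc_ex)
      have "placement_with {(r, c1), (r, c), (r1, c)} i \<sigma>"
        by (rule placement_with_remove[OF \<mu>, of "{(r, c1), (r1, c)}"])
          (use rc ne i \<sigma> D[OF _ rc(1)] D[OF _ rc(2)] in auto)
      then have "ZG_placement i \<sigma>"
        unfolding ZG_placement_def using ne by (intro exI[of _ r] exI[of _ r1] exI[of _ c1] exI[of _ c]) auto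
      then show ?thesis by (rule that(2)[OF i])
    next
      assume a: "r \<in> fst ` \<mu>" "c \<notin> snd ` \<mu>"
      then obtain c1 where rc: "(r, c1) \<in> \<mu>" by auto
      have ne: "c1 \<noteq> c" using rc e by auto
      have "card \<mu> \<noteq> 0" using rc fm by auto
      then obtain i where i: "card \<mu> = i + 1" by (metis Suc_eq_plus1 not0_implies_Suc)
      have "placement_with {(r, c1), (r, c)} i \<sigma>"
        by (rule placement_with_remove[OF \<mu>, of "{(r, c1)}"])
          (use rc ne i \<sigma> D[OF _ rc] a(2) in \<open>auto simp: image_iff\<close>)
      then have "WCG_placement i \<sigma>"
        unfolding WCG_placement_def using ne by (intro exI[of _ r] exI[of _ c1] exI[of _ c]) auto
      then show ?thesis by (rule that(5)[OF i])
    next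
      assume a: "r \<notin> fst ` \<mu>" "c \<in> snd ` \<mu>"
      then obtain r1 where rc: "(r1, c) \<in> \<mu>" by auto
      have ne: "r1 \<noteq> r" using rc e by auto
      have "card \<mu> \<noteq> 0" using rc fm by auto
      then obtain i where i: "card \<mu> = i + 1" by (metis Suc_eq_plus1 not0_implies_Suc)
      have "placement_with {(r1, c), (r, c)} i \<sigma>"
        by (rule placement_with_remove[OF \<mu>, of "{(r1, c)}"])
          (use rc ne i \<sigma> D[OF _ rc] a(1) in \<open>auto simp: image_iff\<close>)
      then have "WRG_placement i \<sigma>"
        unfolding WRG_placement_def using ne by (intro exI[of _ r1] exI[of _ r] exI[of _ c]) auto
      then show ?thesis by (rule that(4)[OF i])
    next
      assume "r \<notin> fst ` \<mu>" "c \<notin> snd ` \<mu>"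
      then show ?thesis using that(1) rook_placement_insert[OF \<mu>] \<sigma> by simp
    qed
  next
    case False
    then obtain r' c' where e': "(r', c') \<in> \<sigma> - \<mu>" "(r, c) \<noteq> (r', c')" using e sub by auto
    have rc: "(r, c') \<in> \<mu>" "(r', c) \<in> \<mu>" using sq[OF e e'] by auto
    have ne: "r \<noteq> r'" "c' \<noteq> c" using rc e by auto
    \<comment> \<open>A third extra edge would also form a square with \<open>(r, c)\<close>, and
      the edges of \<open>\<mu>\<close> at \<open>r\<close> and \<open>c\<close> then force it to be
      \<open>(r', c')\<close>.\<close>
    have "x \<in> {(r, c), (r', c')} \<union> \<mu>" if x: "x \<in> \<sigma>" for x
    proof (rule ccontr)
      assume n: "\<not> ?thesis"
      obtain r'' c'' where x': "x = (r'', c'')" by force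
      have "(r, c'') \<in> \<mu> \<and> (r'', c) \<in> \<mu>" by (rule sq[OF e]) (use n x x' in auto)
      then have "x = (r', c')" using D rc x' by blast
      then show False using n by simp
    qed
    then have \<sigma>: "\<sigma> = {(r, c), (r, c'), (r', c), (r', c')} \<union> \<mu>" using e e' sub rc by auto
    have "{(r, c'), (r', c)} \<subseteq> \<mu>" using rc by simp
    then have "2 \<le> card \<mu>" using card_mono[OF fm, of "{(r, c'), (r', c)}"] ne by simp
    then obtain i where i: "card \<mu> = i + 2" by (metis add.commute le_Suc_ex)
    have "placement_with {(r, c), (r, c'), (r', c), (r', c')} i \<sigma>"
      by (rule placement_with_remove[OF \<mu>, of "{(r, c'), (r', c)}"])
        (use rc ne i \<sigma> D[OF _ rc(1)] D[OF _ rc(2)] in auto)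
    then have "SG_placement i \<sigma>"
      unfolding SG_placement_def using ne by (intro exI[of _ r] exI[of _ r'] exI[of _ c] exI[of _ c']) auto
    then show ?thesis by (rule that(3)[OF i])
  qed
qed

section \<open>Weight of a single support modulo \<open>(q - 1)\<^sup>2\<close>\<close>

text \<open>\<open>w\<close> is the contribution of one support to the normalised count. It is
  explicit for the five listed types; any other support that admits rank \<open>d\<close> contains a
  free set with \<open>d + 2\<close> edges, which makes \<open>w\<close> a multiple of
  \<open>(q - 1)\<^sup>2\<close>.\<close>

lemma supp_rank_funs_weight:
  fixes \<sigma> :: "('r \<times> 'c) set"
  assumes fin: "finite \<sigma>"
  defines "q \<equiv> int CARD('a::{field,finite})"
  shows "\<exists>w. int (card (supp_rank_funs \<sigma> d :: ('r \<times> 'c \<Rightarrow> 'a) set)) = (q - 1) ^ d * w \<and>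
    [w = of_bool (rook_placement \<sigma> \<and> card \<sigma> = d) + (q - 1) *
       (of_bool (\<exists>i. d = i + 2 \<and> ZG_placement i \<sigma>) - of_bool (\<exists>i. d = i + 2 \<and> SG_placement i \<sigma>)
        + of_bool (\<exists>i. d = i + 1 \<and> WRG_placement i \<sigma>) + of_bool (\<exists>i. d = i + 1 \<and> WCG_placement i \<sigma>))]
    (mod (q - 1)\<^sup>2)"
    (is "\<exists>w. int (card ?S) = _ \<and> [w = of_bool ?X + _ * (of_bool ?Z - of_bool ?Q + of_bool ?R + of_bool ?C)] (mod _)")
proof -
  \<comment> \<open>The field contains 0 and 1, so the truncated differences of natural numbers
    agree with those of integers.\<close>
  have "card {0, 1 :: 'a} \<le> CARD('a)" by (intro card_mono) auto
  then have q2: "2 \<le> CARD('a)" by simp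
  then have q1: "int (CARD('a) - 1) = q - 1" and q2': "int (CARD('a) - 2) = q - 2"
    by (auto simp: q_def)
  define bX where "bX \<longleftrightarrow> ?X"
  define bZ where "bZ \<longleftrightarrow> ?Z"
  define bQ where "bQ \<longleftrightarrow> ?Q"
  define bR where "bR \<longleftrightarrow> ?R"
  define bC where "bC \<longleftrightarrow> ?C"
  have X: "card \<sigma> = d \<and> card (fst ` \<sigma>) = d \<and> card (snd ` \<sigma>) = d" if bX
    using that card_rook_placement[of \<sigma>] by (simp add: bX_def)
  have Z: "card \<sigma> = d + 1 \<and> card (fst ` \<sigma>) = d \<and> card (snd ` \<sigma>) = d" if bZ
    using that ZG_placement_card[of _ \<sigma>] by (auto simp: bZ_def)
  have Q: "card \<sigma> = d + 2 \<and> card (fst ` \<sigma>) = d \<and> card (snd ` \<sigma>) = d" if bQ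
    using that SG_placement_card[of _ \<sigma>] by (auto simp: bQ_def)
  have R: "card \<sigma> = d + 1 \<and> card (fst ` \<sigma>) = d + 1 \<and> card (snd ` \<sigma>) = d" if bR
    using that WRG_placement_card[of _ \<sigma>] by (auto simp: bR_def)
  have C: "card \<sigma> = d + 1 \<and> card (fst ` \<sigma>) = d \<and> card (snd ` \<sigma>) = d + 1" if bC
    using that WCG_placement_card[of _ \<sigma>] by (auto simp: bC_def)
  \<comment> \<open>The triples of cell, row and column numbers are pairwise different, hence at
    most one of the five indicators is 1.\<close>
  have nX: "\<not> bX" if "card \<sigma> \<noteq> d \<or> card (fst ` \<sigma>) \<noteq> d \<or> card (snd ` \<sigma>) \<noteq> d"
    using that X by blast
  have nZ: "\<not> bZ" if "card \<sigma> \<noteq> d + 1 \<or> card (fst ` \<sigma>) \<noteq> d \<or> card (snd ` \<sigma>) \<noteq> d"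
    using that Z by blast
  have nQ: "\<not> bQ" if "card \<sigma> \<noteq> d + 2 \<or> card (fst ` \<sigma>) \<noteq> d \<or> card (snd ` \<sigma>) \<noteq> d"
    using that Q by blast
  have nR: "\<not> bR" if "card \<sigma> \<noteq> d + 1 \<or> card (fst ` \<sigma>) \<noteq> d + 1 \<or> card (snd ` \<sigma>) \<noteq> d"
    using that R by blast
  have nC: "\<not> bC" if "card \<sigma> \<noteq> d + 1 \<or> card (fst ` \<sigma>) \<noteq> d \<or> card (snd ` \<sigma>) \<noteq> d + 1"
    using that C by blast
  consider bX | bZ | bQ | bR | bC | "\<not> bX" "\<not> bZ" "\<not> bQ" "\<not> bR" "\<not> bC" by blast
  then have "\<exists>w. int (card ?S) = (q - 1) ^ d * w \<and>
    [w = of_bool bX + (q - 1) * (of_bool bZ - of_bool bQ + of_bool bR + of_bool bC)] (mod (q - 1)\<^sup>2)"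
  proof cases
    case 1
    have "\<not> bZ" "\<not> bQ" "\<not> bR" "\<not> bC"
      by (rule nX nZ nQ nR nC, use X[OF 1] in simp)+
    moreover have "int (card ?S) = (q - 1) ^ d * 1"
      using 1 card_rook_placement_funs[of \<sigma>, where 'a = 'a] q1 by (auto simp: bX_def)
    ultimately show ?thesis using 1 by (intro exI[of _ 1]) simp
  next
    case 2
    have "\<not> bX" "\<not> bQ" "\<not> bR" "\<not> bC"
      by (rule nX nZ nQ nR nC, use Z[OF 2] in simp)+
    moreover have "int (card ?S) = (q - 1) ^ d * (q - 1)"
      using 2 card_ZG_placement_funs[of _ \<sigma>, where 'a = 'a] q1 by (auto simp: bZ_def numeral_3_eq_3)
    ultimately show ?thesis using 2 by (intro exI[of _ "q - 1"]) simp
  next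
    case 3
    have "\<not> bX" "\<not> bZ" "\<not> bR" "\<not> bC"
      by (rule nX nZ nQ nR nC, use Q[OF 3] in simp)+
    moreover have "int (card ?S) = (q - 1) ^ d * ((q - 1) * (q - 2))"
      using 3 card_SG_placement_funs[of _ \<sigma>, where 'a = 'a] q1 q2' by (auto simp: bQ_def numeral_3_eq_3)
    \<comment> \<open>The two sides differ by exactly \<open>(q - 1)\<^sup>2\<close>; this is the
      origin of the minus sign of \<open>SG\<close>.\<close>
    moreover have "[(q - 1) * (q - 2) = - (q - 1)] (mod (q - 1)\<^sup>2)"
      by (simp add: cong_iff_dvd_diff power2_eq_square algebra_simps)
    ultimately show ?thesis using 3 by (intro exI[of _ "(q - 1) * (q - 2)"]) simp
  next
    case 4
    have "\<not> bX" "\<not> bZ" "\<not> bQ" "\<not> bC"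
      by (rule nX nZ nQ nR nC, use R[OF 4] in simp)+
    moreover have "int (card ?S) = (q - 1) ^ d * (q - 1)"
      using 4 card_WRG_placement_funs[of _ \<sigma>, where 'a = 'a] q1 by (auto simp: bR_def)
    ultimately show ?thesis using 4 by (intro exI[of _ "q - 1"]) simp
  next
    case 5
    have "\<not> bX" "\<not> bZ" "\<not> bQ" "\<not> bR"
      by (rule nX nZ nQ nR nC, use C[OF 5] in simp)+
    moreover have "int (card ?S) = (q - 1) ^ d * (q - 1)"
      using 5 card_WCG_placement_funs[of _ \<sigma>, where 'a = 'a] q1 by (auto simp: bC_def)
    ultimately show ?thesis using 5 by (intro exI[of _ "q - 1"]) simp
  next
    case 6
    have "\<exists>k. int (card ?S) = (q - 1) ^ (d + 2) * k"
    proof (cases "?S = {}")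
      case True
      then show ?thesis by (intro exI[of _ 0]) simp
    next
      case False
      then obtain f :: "'r \<times> 'c \<Rightarrow> 'a" where f: "fun_supp f = \<sigma>" "has_rank f d"
        by (auto simp: supp_rank_funs_def)
      obtain \<mu> where \<mu>: "\<mu> \<subseteq> \<sigma>" "rook_placement \<mu>" "card \<mu> = d"
        using has_rank_rook_placement[OF f(2)] f(1) fin by auto
      \<comment> \<open>A rook placement as support would force the rank to be
        \<open>card \<sigma>\<close>, which contradicts the failure of \<open>bX\<close>.\<close>
      have "\<not> rook_placement \<sigma>"
        using 6(1) has_rank_unique[OF f(2)] rook_placement_has_rank[OF _ f(1)] by (auto simp: bX_def)
      have "\<exists>F\<subseteq>\<sigma>. torus_free TYPE('a) F \<and> card F = d + 2"
      proof (rule ccontr)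
        assume "\<not> ?thesis"
        then have nf: "card F \<noteq> card \<mu> + 2" if "F \<subseteq> \<sigma>" "torus_free TYPE('a) F" for F
          using that \<mu>(3) by blast
        show False
          by (rule rook_placement_extension_cases[OF \<mu>(2,1) fin nf])
            (use 6 \<mu>(3) \<open>\<not> rook_placement \<sigma>\<close> in \<open>auto simp: bZ_def bQ_def bR_def bC_def\<close>)
      qed
      then obtain F where F: "F \<subseteq> \<sigma>" "torus_free TYPE('a) F" "card F = d + 2" by blast
      show ?thesis
        using card_supp_rank_funs[OF F(2,1) finite_subset[OF F(1) fin], of d] F(3) q1
        by (intro exI[of _ "int (card {f :: 'r \<times> 'c \<Rightarrow> 'a. f \<in> supp_rank_funs \<sigma> d \<and> (\<forall>e\<in>F. f e = 1)})"])
          simp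
    qed
    then obtain k where "int (card ?S) = (q - 1) ^ (d + 2) * k" by blast
    then have "int (card ?S) = (q - 1) ^ d * ((q - 1)\<^sup>2 * k)" by (simp only: power_add mult.assoc)
    then show ?thesis using 6 by (intro exI[of _ "(q - 1)\<^sup>2 * k"]) (simp add: cong_iff_dvd_diff)
  qed
  then show ?thesis unfolding bX_def bZ_def bQ_def bR_def bC_def .
qed

section \<open>Graph isomorphism\<close>

lemma bij_betw_case_sum:
  assumes "inj_on f A" "inj_on g B" "f ` A \<inter> g ` B = {}"
  shows "bij_betw (case_sum f g) (A <+> B) (f ` A \<union> g ` B)"
proof (rule bij_betw_imageI)
  have ne: "f x \<noteq> g y" if "x \<in> A" "y \<in> B" for x y
    using that assms(3) by (metis disjoint_iff image_eqI)
  show "inj_on (case_sum f g) (A <+> B)"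
  proof (rule inj_onI)
    fix x y assume "x \<in> A <+> B" "y \<in> A <+> B" "case_sum f g x = case_sum f g y"
    then show "x = y"
      by (elim PlusE) (auto dest: inj_onD[OF assms(1)] inj_onD[OF assms(2)] ne ne[symmetric])
  qed
  show "case_sum f g ` (A <+> B) = f ` A \<union> g ` B" by (auto simp: Plus_def image_Un image_image)
qed

lemma bigraph_iso_sym:
  assumes "bigraph_iso G H"
  shows "bigraph_iso H G"
proof -
  obtain f g where f: "bij_betw f (row_verts G) (row_verts H)" and g: "bij_betw g (col_verts G) (col_verts H)"
    and e: "\<And>r c. r \<in> row_verts G \<Longrightarrow> c \<in> col_verts G \<Longrightarrow> (r, c) \<in> edges G \<longleftrightarrow> (f r, g c) \<in> edges H"
    using assms unfolding bigraph_iso_def by blast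
  let ?f = "inv_into (row_verts G) f" and ?g = "inv_into (col_verts G) g"
  have "(r, c) \<in> edges H \<longleftrightarrow> (?f r, ?g c) \<in> edges G" if "r \<in> row_verts H" "c \<in> col_verts H" for r c
  proof -
    have "?f r \<in> row_verts G" "?g c \<in> col_verts G" "f (?f r) = r" "g (?g c) = c"
      using that f g by (auto simp: bij_betw_def inv_into_into f_inv_into_f)
    then show ?thesis using e[of "?f r" "?g c"] by simp
  qed
  moreover have "bij_betw ?f (row_verts H) (row_verts G)" "bij_betw ?g (col_verts H) (col_verts G)"
    using f g by (auto intro: bij_betw_inv_into)
  ultimately show ?thesis unfolding bigraph_iso_def by (intro exI[of _ ?f] exI[of _ ?g]) simp
qed

text \<open>When all edges run between listed vertices, bijectivity of the vertex maps turns the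
  equivalence of adjacencies into an equality of edge sets, which splits along unions.\<close>

lemma bigraph_iso_iff_image:
  assumes G: "edges G \<subseteq> row_verts G \<times> col_verts G" and H: "edges H \<subseteq> row_verts H \<times> col_verts H"
  shows "bigraph_iso G H \<longleftrightarrow> (\<exists>f g. bij_betw f (row_verts G) (row_verts H) \<and>
    bij_betw g (col_verts G) (col_verts H) \<and> map_prod f g ` edges G = edges H)"
proof -
  have "(\<forall>r\<in>row_verts G. \<forall>c\<in>col_verts G. (r, c) \<in> edges G \<longleftrightarrow> (f r, g c) \<in> edges H) \<longleftrightarrow>
      map_prod f g ` edges G = edges H" (is "?L \<longleftrightarrow> ?R")
    if f: "bij_betw f (row_verts G) (row_verts H)" and g: "bij_betw g (col_verts G) (col_verts H)" for f g
  proof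
    assume L: ?L
    show ?R
    proof
      show "map_prod f g ` edges G \<subseteq> edges H" using L G by auto
      show "edges H \<subseteq> map_prod f g ` edges G"
      proof
        fix x assume x: "x \<in> edges H"
        then have "fst x \<in> f ` row_verts G" "snd x \<in> g ` col_verts G"
          using H f g by (auto simp: bij_betw_def)
        then obtain r c where rc: "r \<in> row_verts G" "c \<in> col_verts G" "x = (f r, g c)"
          by (metis image_iff prod.collapse)
        then have "(r, c) \<in> edges G" using L x by simp
        then show "x \<in> map_prod f g ` edges G" using rc(3) by force
      qed
    qed
  next
    assume R: ?R
    show ?L
    proof (intro ballI iffI)
      fix r c assume rc: "r \<in> row_verts G" "c \<in> col_verts G"
      show "(f r, g c) \<in> edges H" if "(r, c) \<in> edges G" using R that by force
      show "(r, c) \<in> edges G" if fg: "(f r, g c) \<in> edges H"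
      proof -
        obtain r' c' where e: "(r', c') \<in> edges G" "f r' = f r" "g c' = g c"
        proof -
          have "(f r, g c) \<in> map_prod f g ` edges G" using R fg by simp
          then show ?thesis by (elim imageE) (auto intro: that)
        qed
        then have "r' = r" "c' = c"
          using rc G f g by (auto simp: bij_betw_def dest!: inj_onD)
        then show ?thesis using e by simp
      qed
    qed
  qed
  then show ?thesis unfolding bigraph_iso_def by blast
qed

section \<open>Padded graphs as placements\<close>

abbreviation padded_graph :: "('r, 'c) bigraph \<Rightarrow> nat \<Rightarrow> nat \<Rightarrow> nat \<Rightarrow>
    (('r + (nat \<times> nat)) + nat, ('c + (nat \<times> nat)) + nat) bigraph" where
  "padded_graph G i a b \<equiv> bigraph_union (bigraph_union G (bigraph_copies i EG)) (edgeless a b)"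

lemma padded_graph_sel:
  shows "row_verts (padded_graph G i a b) = (row_verts G <+> {1..i} \<times> {1}) <+> {1..a}"
    and "col_verts (padded_graph G i a b) = (col_verts G <+> {1..i} \<times> {1}) <+> {1..b}"
    and "edges (padded_graph G i a b) = map_prod (Inl \<circ> Inl) (Inl \<circ> Inl) ` edges G \<union>
      (\<lambda>k. (Inl (Inr (k, 1)), Inl (Inr (k, 1)))) ` {1..i}"
proof -
  have "{((k, r), k, c) |k r c. k \<in> {1..i} \<and> (r, c) \<in> edges EG} = (\<lambda>k. ((k, 1), (k, 1))) ` {1..i}"
    by (auto simp: EG_def)
  then show "edges (padded_graph G i a b) = map_prod (Inl \<circ> Inl) (Inl \<circ> Inl) ` edges G \<union>
      (\<lambda>k. (Inl (Inr (k, 1)), Inl (Inr (k, 1)))) ` {1..i}"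
    by (simp add: bigraph_union_def bigraph_copies_def edgeless_def image_Un image_image map_prod_def
        case_prod_unfold)
qed (simp_all add: bigraph_union_def bigraph_copies_def edgeless_def EG_def)

text \<open>The positions left over by \<open>f\<close> and \<open>h\<close> are enumerated by
  \<open>s\<close>; their number is the size \<open>a\<close> of the edgeless part. The lemma serves
  rows and columns alike.\<close>

lemma ex_bij_betw_padded:
  fixes f :: "'r \<Rightarrow> nat" and h :: "nat \<Rightarrow> nat" and i m :: nat
  assumes f: "inj_on f R" and h: "inj_on h {1..i}" "h ` {1..i} \<inter> f ` R = {}"
    and m: "f ` R \<subseteq> {1..m}" "h ` {1..i} \<subseteq> {1..m}"
  obtains a \<Phi> where "bij_betw \<Phi> ((R <+> {1..i} \<times> {1::nat}) <+> {1..a::nat}) {1..m}"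
    "\<And>r. \<Phi> (Inl (Inl r)) = f r" "\<And>k. \<Phi> (Inl (Inr (k, 1))) = h k"
proof -
  define S where "S = {1..m} - (f ` R \<union> h ` {1..i})"
  obtain s where s: "bij_betw s {1..card S} S"
    using ex_bij_betw_nat_finite_1[of S] by (auto simp: S_def)
  have "inj_on (\<lambda>x. h (fst x)) ({1..i} \<times> {1::nat})"
    by (rule inj_onI) (auto dest: inj_onD[OF h(1)])
  moreover have hi: "(\<lambda>x. h (fst x)) ` ({1..i} \<times> {1::nat}) = h ` {1..i}" by force
  ultimately have 1: "bij_betw (case_sum f (\<lambda>x. h (fst x))) (R <+> {1..i} \<times> {1::nat}) (f ` R \<union> h ` {1..i})"
    using bij_betw_case_sum[OF f, of "\<lambda>x. h (fst x)" "{1..i} \<times> {1::nat}"] h(2) by (simp add: Int_commute)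
  let ?\<Phi> = "case_sum (case_sum f (\<lambda>x. h (fst x))) s"
  have "bij_betw ?\<Phi> ((R <+> {1..i} \<times> {1::nat}) <+> {1..card S}) ((f ` R \<union> h ` {1..i}) \<union> S)"
  proof -
    have i1: "inj_on (case_sum f (\<lambda>x. h (fst x))) (R <+> {1..i} \<times> {1::nat})"
      and r1: "case_sum f (\<lambda>x. h (fst x)) ` (R <+> {1..i} \<times> {1::nat}) = f ` R \<union> h ` {1..i}"
      using 1 unfolding bij_betw_def by (rule conjunct1, rule conjunct2)
    have i2: "inj_on s {1..card S}" and r2: "s ` {1..card S} = S"
      using s unfolding bij_betw_def by (rule conjunct1, rule conjunct2)
    have "(f ` R \<union> h ` {1..i}) \<inter> S = {}" by (auto simp: S_def)
    from bij_betw_case_sum[OF i1 i2, unfolded r1 r2, OF this] show ?thesis .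
  qed
  moreover have "(f ` R \<union> h ` {1..i}) \<union> S = {1..m}" using m by (auto simp: S_def)
  ultimately show ?thesis using that[of ?\<Phi> "card S"] by simp
qed

text \<open>\<open>G\<close> has no isolated vertices, so the rows and columns of an embedded copy
  can be read off its cells. An isomorphism splits into an embedding of \<open>G\<close>, the cells
  of the copies of \<open>EG\<close>, and a remainder; conversely, these data extend to bijections
  by filling up with isolated vertices.\<close>

lemma ex_iso_padded_graph_iff:
  fixes G :: "('r, 'c) bigraph"
  assumes \<sigma>: "\<sigma> \<subseteq> {1..m} \<times> {1..n}"
    and G: "fst ` edges G = row_verts G" "snd ` edges G = col_verts G"
  shows "(\<exists>a b. bigraph_iso (board_graph m n \<sigma>) (padded_graph G i a b)) \<longleftrightarrow>
    (\<exists>f g. inj_on f (row_verts G) \<and> inj_on g (col_verts G) \<and> placement_with (map_prod f g ` edges G) i \<sigma>)"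
    (is "?L \<longleftrightarrow> ?R")
proof -
  let ?H = "padded_graph G i"
  have GE: "edges G \<subseteq> row_verts G \<times> col_verts G" using G by (metis subset_fst_snd)
  have HE: "edges (?H a b) \<subseteq> row_verts (?H a b) \<times> col_verts (?H a b)" for a b
    unfolding padded_graph_sel using GE by auto
  have sel: "row_verts (board_graph m n \<sigma>) = {1..m}" "col_verts (board_graph m n \<sigma>) = {1..n}"
    "edges (board_graph m n \<sigma>) = \<sigma>" by (simp_all add: board_graph_def)
  \<comment> \<open>Isomorphisms are read from the padded graph towards the board, where the image
    of the edge set is \<open>\<sigma>\<close>.\<close>
  have iso: "bigraph_iso (board_graph m n \<sigma>) (?H a b) \<longleftrightarrow>
    (\<exists>\<Phi> \<Psi>. bij_betw \<Phi> (row_verts (?H a b)) {1..m} \<and> bij_betw \<Psi> (col_verts (?H a b)) {1..n} \<and>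
      map_prod \<Phi> \<Psi> ` edges (?H a b) = \<sigma>)" for a b
  proof -
    have "bigraph_iso (board_graph m n \<sigma>) (?H a b) \<longleftrightarrow> bigraph_iso (?H a b) (board_graph m n \<sigma>)"
      by (rule iffI) (erule bigraph_iso_sym)+
    then show ?thesis using bigraph_iso_iff_image[OF HE, of "board_graph m n \<sigma>" a b] \<sigma> unfolding sel by simp
  qed
  have img: "map_prod \<Phi> \<Psi> ` edges (?H a b) =
      map_prod (\<lambda>r. \<Phi> (Inl (Inl r))) (\<lambda>c. \<Psi> (Inl (Inl c))) ` edges G \<union>
      (\<lambda>k. (\<Phi> (Inl (Inr (k, 1))), \<Psi> (Inl (Inr (k, 1))))) ` {1..i}" for \<Phi> :: "_ \<Rightarrow> nat" and \<Psi> :: "_ \<Rightarrow> nat" and a b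
    unfolding padded_graph_sel by (simp add: image_Un image_image map_prod_def case_prod_unfold)
  show ?thesis
  proof
    assume ?L
    then obtain a b \<Phi> \<Psi> where \<Phi>: "inj_on \<Phi> (row_verts (?H a b))" and \<Psi>: "inj_on \<Psi> (col_verts (?H a b))"
      and e: "map_prod \<Phi> \<Psi> ` edges (?H a b) = \<sigma>"
      unfolding iso bij_betw_def by blast
    let ?f = "\<lambda>r. \<Phi> (Inl (Inl r))" and ?g = "\<lambda>c. \<Psi> (Inl (Inl c))"
    let ?u = "\<lambda>k. \<Phi> (Inl (Inr (k, 1)))" and ?v = "\<lambda>k. \<Psi> (Inl (Inr (k, 1)))"
    \<comment> \<open>The copy of \<open>EG\<close> with number \<open>k\<close> occupies the cell
      with row \<open>?u k\<close> and column \<open>?v k\<close>.\<close>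
    let ?\<mu> = "(\<lambda>k. (?u k, ?v k)) ` {1..i}"
    have f: "inj_on ?f (row_verts G)" and g: "inj_on ?g (col_verts G)"
      and u: "inj_on ?u {1..i}" and v: "inj_on ?v {1..i}"
      using \<Phi> \<Psi> unfolding padded_graph_sel by (auto simp: inj_on_def)
    have fu: "?u ` {1..i} \<inter> ?f ` row_verts G = {}" and gv: "?v ` {1..i} \<inter> ?g ` col_verts G = {}"
      using \<Phi> \<Psi> unfolding padded_graph_sel by (auto simp: inj_on_def)
    have "placement_with (map_prod ?f ?g ` edges G) i \<sigma>"
      unfolding placement_with_def
    proof (intro exI[of _ ?\<mu>] conjI)
      have "inj_on fst ?\<mu>" "inj_on snd ?\<mu>"
        by (rule inj_on_imageI, unfold comp_def fst_conv snd_conv, rule u v)+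
      then show "rook_placement ?\<mu>" by (simp add: rook_placement_def)
      have "inj_on (\<lambda>k. (?u k, ?v k)) {1..i}" by (rule inj_onI, rule inj_onD[OF u]) auto
      then show "card ?\<mu> = i" by (simp add: card_image)
      have "fst ` map_prod ?f ?g ` edges G = ?f ` fst ` edges G" by (simp add: image_image)
      then show "fst ` ?\<mu> \<inter> fst ` map_prod ?f ?g ` edges G = {}"
        using fu G(1) by (simp add: image_image)
      have "snd ` map_prod ?f ?g ` edges G = ?g ` snd ` edges G" by (simp add: image_image)
      then show "snd ` ?\<mu> \<inter> snd ` map_prod ?f ?g ` edges G = {}"
        using gv G(2) by (simp add: image_image)
      show "\<sigma> = map_prod ?f ?g ` edges G \<union> ?\<mu>" using e img by simp
    qed
    then show ?R using f g by blast
  next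
    assume ?R
    then obtain f g \<mu> where f: "inj_on f (row_verts G)" and g: "inj_on g (col_verts G)"
      and \<mu>: "rook_placement \<mu>" "card \<mu> = i" "fst ` \<mu> \<inter> fst ` map_prod f g ` edges G = {}"
        "snd ` \<mu> \<inter> snd ` map_prod f g ` edges G = {}" and \<sigma>e: "\<sigma> = map_prod f g ` edges G \<union> \<mu>"
      unfolding placement_with_def by blast
    have fin: "finite \<mu>" and inj: "inj_on fst \<mu>" "inj_on snd \<mu>" using \<mu>(1) by (auto simp: rook_placement_def)
    \<comment> \<open>Numbering the cells of \<open>\<mu>\<close> assigns one of them to every copy
      of \<open>EG\<close>.\<close>
    obtain h where h: "bij_betw h {1..i} \<mu>"
      using ex_bij_betw_nat_finite_1[OF fin] \<mu>(2) by auto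
    have hi: "h ` {1..i} = \<mu>" "inj_on h {1..i}" using h by (auto simp: bij_betw_def)
    have fE: "fst ` map_prod f g ` edges G = f ` row_verts G"
      unfolding G(1)[symmetric] by (simp add: image_image)
    have gE: "snd ` map_prod f g ` edges G = g ` col_verts G"
      unfolding G(2)[symmetric] by (simp add: image_image)
    have u: "(\<lambda>k. fst (h k)) ` {1..i} = fst ` \<mu>" and v: "(\<lambda>k. snd (h k)) ` {1..i} = snd ` \<mu>"
      unfolding hi(1)[symmetric] by (simp_all add: image_image)
    have ui: "inj_on (\<lambda>k. fst (h k)) {1..i}" and vi: "inj_on (\<lambda>k. snd (h k)) {1..i}"
      using comp_inj_on[OF hi(2), of fst] comp_inj_on[OF hi(2), of snd] inj hi(1) by (simp_all add: comp_def)
    have sub: "f ` row_verts G \<subseteq> {1..m}" "fst ` \<mu> \<subseteq> {1..m}" "g ` col_verts G \<subseteq> {1..n}" "snd ` \<mu> \<subseteq> {1..n}"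
      unfolding fE[symmetric] gE[symmetric] using \<sigma> unfolding \<sigma>e by force+
    obtain a \<Phi> where \<Phi>: "bij_betw \<Phi> ((row_verts G <+> {1..i} \<times> {1::nat}) <+> {1..a::nat}) {1..m}"
      "\<And>r. \<Phi> (Inl (Inl r)) = f r" "\<And>k. \<Phi> (Inl (Inr (k, 1))) = fst (h k)"
      by (rule ex_bij_betw_padded[OF f ui, of m]) (use u \<mu>(3) fE sub in auto)
    obtain b \<Psi> where \<Psi>: "bij_betw \<Psi> ((col_verts G <+> {1..i} \<times> {1::nat}) <+> {1..b::nat}) {1..n}"
      "\<And>r. \<Psi> (Inl (Inl r)) = g r" "\<And>k. \<Psi> (Inl (Inr (k, 1))) = snd (h k)"
      by (rule ex_bij_betw_padded[OF g vi, of n]) (use v \<mu>(4) gE sub in auto)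
    have "map_prod \<Phi> \<Psi> ` edges (?H a b) = \<sigma>"
      unfolding img \<Phi>(2,3) \<Psi>(2,3) using hi(1) \<sigma>e by simp
    moreover have "bij_betw \<Phi> (row_verts (?H a b)) {1..m}" "bij_betw \<Psi> (col_verts (?H a b)) {1..n}"
      unfolding padded_graph_sel by (rule \<Phi>(1), rule \<Psi>(1))
    ultimately show ?L unfolding iso by blast
  qed
qed

text \<open>The existential over \<open>i\<close> makes the set on the right empty for
  \<open>d < k\<close>, in agreement with the convention for negative indices.\<close>

lemma graph_rook_number_eq:
  assumes B: "B \<subseteq> {1..m} \<times> {1..n}"
    and G: "fst ` edges G = row_verts G" "snd ` edges G = col_verts G"
    and P: "\<And>i \<sigma>. P i \<sigma> \<longleftrightarrow> (\<exists>f g. inj_on f (row_verts G) \<and> inj_on g (col_verts G) \<and>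
      placement_with (map_prod f g ` edges G) i \<sigma>)"
  shows "graph_rook_number G (int d - int k) m n B = card {\<sigma> \<in> Pow B. \<exists>i. d = i + k \<and> P i \<sigma>}"
proof (cases "d < k")
  case True
  then have "{\<sigma> \<in> Pow B. \<exists>i. d = i + k \<and> P i \<sigma>} = {}" by auto
  then show ?thesis using True by (simp add: graph_rook_number_def)
next
  case False
  then have nat: "nat (int d - int k) = d - k" "\<not> int d - int k < 0" by auto
  have "(\<exists>a b. bigraph_iso (board_graph m n \<sigma>) (padded_graph G (d - k) a b)) \<longleftrightarrow> (\<exists>i. d = i + k \<and> P i \<sigma>)"
    if "\<sigma> \<subseteq> B" for \<sigma>
  proof -
    have "(\<exists>a b. bigraph_iso (board_graph m n \<sigma>) (padded_graph G (d - k) a b)) \<longleftrightarrow> P (d - k) \<sigma>"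
      unfolding P by (rule ex_iso_padded_graph_iff[OF _ G]) (use that B in auto)
    also have "\<dots> \<longleftrightarrow> (\<exists>i. d = i + k \<and> P i \<sigma>)" using False by (metis add_diff_cancel_right' le_add_diff_inverse2 not_le)
    finally show ?thesis .
  qed
  then have "{\<sigma>. \<sigma> \<subseteq> B \<and> (\<exists>a b. bigraph_iso (board_graph m n \<sigma>) (padded_graph G (d - k) a b))} =
      {\<sigma> \<in> Pow B. \<exists>i. d = i + k \<and> P i \<sigma>}" by auto
  then show ?thesis unfolding graph_rook_number_def nat using nat(2) by simp
qed

section \<open>Rook numbers of the four graphs\<close>

text \<open>This converts embeddings of a two-element vertex class into the named vertices of the
  placement definitions.\<close>

lemma ex_inj_on_pair:
  "(\<exists>f :: nat \<Rightarrow> 'b. inj_on f {1, 2} \<and> Q (f 1) (f 2)) \<longleftrightarrow> (\<exists>x y. x \<noteq> y \<and> Q x y)"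
proof
  assume "\<exists>x y. x \<noteq> y \<and> Q x y"
  then obtain x y where "x \<noteq> y" "Q x y" by blast
  then show "\<exists>f :: nat \<Rightarrow> 'b. inj_on f {1, 2} \<and> Q (f 1) (f 2)"
    by (intro exI[of _ "\<lambda>k. if k = 1 then x else y"]) auto
qed auto

lemma ex_fun_at_1: "(\<exists>f :: nat \<Rightarrow> 'b. Q (f 1)) \<longleftrightarrow> (\<exists>x. Q x)"
proof
  assume "\<exists>x. Q x"
  then obtain x where "Q x" by blast
  then show "\<exists>f :: nat \<Rightarrow> 'b. Q (f 1)" by (intro exI[of _ "\<lambda>_. x"])
qed auto

lemma graph_rook_number_ZG:
  assumes "B \<subseteq> {1..m} \<times> {1..n}"
  shows "graph_rook_number ZG (int d - 2) m n B = card {\<sigma> \<in> Pow B. \<exists>i. d = i + 2 \<and> ZG_placement i \<sigma>}"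
proof -
  have "ZG_placement i \<sigma> \<longleftrightarrow> (\<exists>f g. inj_on f (row_verts ZG) \<and> inj_on g (col_verts ZG) \<and>
      placement_with (map_prod f g ` edges ZG) i \<sigma>)" for i and \<sigma> :: board
  proof -
    let ?Q = "\<lambda>r1 r2 c1 c2. placement_with {(r1, c1), (r1, c2), (r2, c2)} i \<sigma>"
    have "(\<exists>f g. inj_on f (row_verts ZG) \<and> inj_on g (col_verts ZG) \<and>
        placement_with (map_prod f g ` edges ZG) i \<sigma>) \<longleftrightarrow>
      (\<exists>f :: nat \<Rightarrow> nat. inj_on f {1, 2} \<and> (\<exists>g :: nat \<Rightarrow> nat. inj_on g {1, 2} \<and> ?Q (f 1) (f 2) (g 1) (g 2)))"
      by (simp add: ZG_def)
    also have "\<dots> \<longleftrightarrow> (\<exists>r1 r2. r1 \<noteq> r2 \<and> (\<exists>c1 c2. c1 \<noteq> c2 \<and> ?Q r1 r2 c1 c2))"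
      by (simp only: ex_inj_on_pair[of "?Q r1 r2" for r1 r2]
          ex_inj_on_pair[of "\<lambda>r1 r2. \<exists>c1 c2. c1 \<noteq> c2 \<and> ?Q r1 r2 c1 c2"])
    also have "\<dots> \<longleftrightarrow> ZG_placement i \<sigma>" unfolding ZG_placement_def by blast
    finally show ?thesis by simp
  qed
  from graph_rook_number_eq[OF assms _ _ this, of d 2] show ?thesis by (auto simp: ZG_def)
qed

lemma graph_rook_number_SG:
  assumes "B \<subseteq> {1..m} \<times> {1..n}"
  shows "graph_rook_number SG (int d - 2) m n B = card {\<sigma> \<in> Pow B. \<exists>i. d = i + 2 \<and> SG_placement i \<sigma>}"
proof -
  have SG: "SG = Bigraph {1, 2} {1, 2} {(1, 1), (1, 2), (2, 1), (2, 2)}" by (auto simp: SG_def)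
  have "SG_placement i \<sigma> \<longleftrightarrow> (\<exists>f g. inj_on f (row_verts SG) \<and> inj_on g (col_verts SG) \<and>
      placement_with (map_prod f g ` edges SG) i \<sigma>)" for i and \<sigma> :: board
  proof -
    let ?Q = "\<lambda>r1 r2 c1 c2. placement_with {(r1, c1), (r1, c2), (r2, c1), (r2, c2)} i \<sigma>"
    have "(\<exists>f g. inj_on f (row_verts SG) \<and> inj_on g (col_verts SG) \<and>
        placement_with (map_prod f g ` edges SG) i \<sigma>) \<longleftrightarrow>
      (\<exists>f :: nat \<Rightarrow> nat. inj_on f {1, 2} \<and> (\<exists>g :: nat \<Rightarrow> nat. inj_on g {1, 2} \<and> ?Q (f 1) (f 2) (g 1) (g 2)))"
      by (simp add: SG)
    also have "\<dots> \<longleftrightarrow> (\<exists>r1 r2. r1 \<noteq> r2 \<and> (\<exists>c1 c2. c1 \<noteq> c2 \<and> ?Q r1 r2 c1 c2))"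
      by (simp only: ex_inj_on_pair[of "?Q r1 r2" for r1 r2]
          ex_inj_on_pair[of "\<lambda>r1 r2. \<exists>c1 c2. c1 \<noteq> c2 \<and> ?Q r1 r2 c1 c2"])
    also have "\<dots> \<longleftrightarrow> SG_placement i \<sigma>" unfolding SG_placement_def by blast
    finally show ?thesis by simp
  qed
  from graph_rook_number_eq[OF assms _ _ this, of d 2] show ?thesis by (auto simp: SG)
qed

lemma graph_rook_number_WRG:
  assumes "B \<subseteq> {1..m} \<times> {1..n}"
  shows "graph_rook_number WRG (int d - 1) m n B = card {\<sigma> \<in> Pow B. \<exists>i. d = i + 1 \<and> WRG_placement i \<sigma>}"
proof -
  have "WRG_placement i \<sigma> \<longleftrightarrow> (\<exists>f g. inj_on f (row_verts WRG) \<and> inj_on g (col_verts WRG) \<and>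
      placement_with (map_prod f g ` edges WRG) i \<sigma>)" for i and \<sigma> :: board
  proof -
    let ?Q = "\<lambda>r1 r2 c. placement_with {(r1, c), (r2, c)} i \<sigma>"
    have "(\<exists>f g. inj_on f (row_verts WRG) \<and> inj_on g (col_verts WRG) \<and>
        placement_with (map_prod f g ` edges WRG) i \<sigma>) \<longleftrightarrow>
      (\<exists>f :: nat \<Rightarrow> nat. inj_on f {1, 2} \<and> (\<exists>g :: nat \<Rightarrow> nat. ?Q (f 1) (f 2) (g 1)))"
      by (simp add: WRG_def)
    also have "\<dots> \<longleftrightarrow> (\<exists>r1 r2. r1 \<noteq> r2 \<and> (\<exists>c. ?Q r1 r2 c))"
      by (simp only: ex_fun_at_1[of "?Q r1 r2" for r1 r2] ex_inj_on_pair[of "\<lambda>r1 r2. \<exists>c. ?Q r1 r2 c"])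
    also have "\<dots> \<longleftrightarrow> WRG_placement i \<sigma>" unfolding WRG_placement_def by blast
    finally show ?thesis by simp
  qed
  from graph_rook_number_eq[OF assms _ _ this, of d 1] show ?thesis by (auto simp: WRG_def)
qed

lemma graph_rook_number_WCG:
  assumes "B \<subseteq> {1..m} \<times> {1..n}"
  shows "graph_rook_number WCG (int d - 1) m n B = card {\<sigma> \<in> Pow B. \<exists>i. d = i + 1 \<and> WCG_placement i \<sigma>}"
proof -
  have "WCG_placement i \<sigma> \<longleftrightarrow> (\<exists>f g. inj_on f (row_verts WCG) \<and> inj_on g (col_verts WCG) \<and>
      placement_with (map_prod f g ` edges WCG) i \<sigma>)" for i and \<sigma> :: board
  proof -
    let ?Q = "\<lambda>r c1 c2. placement_with {(r, c1), (r, c2)} i \<sigma>"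
    have "(\<exists>f g. inj_on f (row_verts WCG) \<and> inj_on g (col_verts WCG) \<and>
        placement_with (map_prod f g ` edges WCG) i \<sigma>) \<longleftrightarrow>
      (\<exists>f :: nat \<Rightarrow> nat. \<exists>g :: nat \<Rightarrow> nat. inj_on g {1, 2} \<and> ?Q (f 1) (g 1) (g 2))"
      by (simp add: WCG_def)
    also have "\<dots> \<longleftrightarrow> (\<exists>r c1 c2. c1 \<noteq> c2 \<and> ?Q r c1 c2)"
      by (simp only: ex_inj_on_pair[of "?Q r" for r] ex_fun_at_1[of "\<lambda>r. \<exists>c1 c2. c1 \<noteq> c2 \<and> ?Q r c1 c2"])
    also have "\<dots> \<longleftrightarrow> WCG_placement i \<sigma>" unfolding WCG_placement_def by blast
    finally show ?thesis by simp
  qed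
  from graph_rook_number_eq[OF assms _ _ this, of d 1] show ?thesis by (auto simp: WCG_def)
qed

section \<open>Counting matrices\<close>

lemma rook_number_eq:
  assumes "finite B"
  shows "rook_number d B = card {\<sigma> \<in> Pow B. rook_placement \<sigma> \<and> card \<sigma> = d}"
proof -
  have "{\<sigma>. \<sigma> \<subseteq> B \<and> finite \<sigma> \<and> card \<sigma> = d \<and>
     (\<forall>x\<in>\<sigma>. \<forall>y\<in>\<sigma>. x \<noteq> y \<longrightarrow> fst x \<noteq> fst y \<and> snd x \<noteq> snd y)} =
     {\<sigma> \<in> Pow B. rook_placement \<sigma> \<and> card \<sigma> = d}"
    unfolding rook_placement_def inj_on_def by blast
  then show ?thesis by (simp add: rook_number_def)
qed

text \<open>The domain may be infinite, but the functions vanish outside the finite set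
  \<open>\<sigma>\<close> and take values in a finite field.\<close>

lemma finite_supp_rank_funs:
  assumes "finite \<sigma>"
  shows "finite (supp_rank_funs \<sigma> d :: ('r \<times> 'c \<Rightarrow> 'a::{field,finite}) set)"
proof (rule finite_subset)
  show "finite {f :: 'r \<times> 'c \<Rightarrow> 'a. \<forall>x. (x \<in> \<sigma> \<longrightarrow> f x \<in> UNIV) \<and> (x \<notin> \<sigma> \<longrightarrow> f x = 0)}"
    by (rule finite_set_of_finite_funs) (use assms in auto)
qed (auto simp: supp_rank_funs_def fun_supp_def)

text \<open>Matrices correspond to functions with support inside \<open>B\<close>, and these are
  sorted by their support.\<close>

lemma mat_count_eq_sum:
  assumes B: "B \<subseteq> {1..m} \<times> {1..n}"
  shows "mat_count TYPE('a::{field,finite}) m n d B =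
    (\<Sum>\<sigma>\<in>Pow B. card (supp_rank_funs \<sigma> d :: (nat \<times> nat \<Rightarrow> 'a) set))"
proof -
  let ?M = "{A :: 'a mat. A \<in> carrier_mat m n \<and> vec_space.rank m A = d \<and> mat_support A \<subseteq> B}"
  let ?U = "\<Union>\<sigma>\<in>Pow B. supp_rank_funs \<sigma> d :: (nat \<times> nat \<Rightarrow> 'a) set"
  \<comment> \<open>Boards start at 1 and matrices at 0, hence the shift; the value outside the
    rectangle is 0. \<open>k\<close> is the inverse on functions supported in
    \<open>B\<close>.\<close>
  define h :: "'a mat \<Rightarrow> nat \<times> nat \<Rightarrow> 'a" where
    "h A = (\<lambda>(i, j). if i \<in> {1..m} \<and> j \<in> {1..n} then A $$ (i - 1, j - 1) else 0)" for A
  define k :: "(nat \<times> nat \<Rightarrow> 'a) \<Rightarrow> 'a mat" where "k f = mat m n (\<lambda>(i, j). f (Suc i, Suc j))" for f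
  have finB: "finite B" using B finite_subset by blast
  have kh: "k (h A) = A" if "A \<in> carrier_mat m n" for A
    using that by (intro eq_matI) (auto simp: k_def h_def)
  have hk: "h (k f) = f" if "fun_supp f \<subseteq> B" for f
  proof
    fix x :: "nat \<times> nat"
    obtain i j where x: "x = (i, j)" by force
    show "h (k f) x = f x"
    proof (cases "i \<in> {1..m} \<and> j \<in> {1..n}")
      case True
      then have "i - 1 < m" "j - 1 < n" "Suc (i - 1) = i" "Suc (j - 1) = j" by auto
      then show ?thesis using True by (simp add: x h_def k_def)
    next
      case False
      then have "x \<notin> fun_supp f" using that B x by auto
      then show ?thesis using False by (auto simp: x h_def fun_supp_def)
    qed
  qed
  have supp: "fun_supp (h A) = mat_support A" if A: "A \<in> carrier_mat m n" for A
  proof (intro Set.set_eqI iffI)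
    fix x assume "x \<in> fun_supp (h A)"
    then obtain i j where x: "x = (i, j)" "i \<in> {1..m}" "j \<in> {1..n}" "A $$ (i - 1, j - 1) \<noteq> 0"
      by (cases x) (auto simp: fun_supp_def h_def split: if_splits)
    then have "x = (Suc (i - 1), Suc (j - 1))" "i - 1 < m" "j - 1 < n" by auto
    then show "x \<in> mat_support A" using A x(4) unfolding mat_support_def by blast
  qed (use A in \<open>auto simp: fun_supp_def h_def mat_support_def\<close>)
  have rank: "has_rank (h A) d \<longleftrightarrow> vec_space.rank m A = d" if A: "A \<in> carrier_mat m n" for A
  proof -
    have "has_rank (h A) (vec_space.rank m A)" by (rule has_rank_vec_space_rank[OF A]) (simp add: h_def)
    then show ?thesis using has_rank_unique by auto
  qed
  have "bij_betw h ?M ?U"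
  proof (rule bij_betw_byWitness[where f' = k])
    show "\<forall>A\<in>?M. k (h A) = A" using kh by simp
    show "\<forall>f\<in>?U. h (k f) = f" using hk by (auto simp: supp_rank_funs_def)
    show "h ` ?M \<subseteq> ?U"
    proof
      fix f assume "f \<in> h ` ?M"
      then obtain A where A: "f = h A" "A \<in> carrier_mat m n" "vec_space.rank m A = d" "mat_support A \<subseteq> B"
        by blast
      then have "f \<in> supp_rank_funs (mat_support A) d" using supp rank by (simp add: supp_rank_funs_def)
      then show "f \<in> ?U" using A(4) by blast
    qed
    show "k ` ?U \<subseteq> ?M"
    proof
      fix A assume "A \<in> k ` ?U"
      then obtain f where f: "A = k f" "fun_supp f \<subseteq> B" "has_rank f d" by (auto simp: supp_rank_funs_def)
      have A: "A \<in> carrier_mat m n" using f(1) by (simp add: k_def)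
      have "h A = f" using hk f by simp
      then show "A \<in> ?M" using A supp[OF A] rank[OF A] f by simp
    qed
  qed
  then have "mat_count TYPE('a) m n d B = card ?U" by (simp add: mat_count_def bij_betw_same_card)
  also have "\<dots> = (\<Sum>\<sigma>\<in>Pow B. card (supp_rank_funs \<sigma> d :: (nat \<times> nat \<Rightarrow> 'a) set))"
  proof (rule card_UN_disjoint)
    show "finite (Pow B)" using finB by simp
    show "\<forall>\<sigma>\<in>Pow B. finite (supp_rank_funs \<sigma> d :: (nat \<times> nat \<Rightarrow> 'a) set)"
      using finB finite_subset by (auto intro: finite_supp_rank_funs)
  qed (auto simp: supp_rank_funs_def)
  finally show ?thesis .
qed

section \<open>Summation over all supports\<close>

theorem theorem3p10:
  fixes m n d q :: nat and B :: board
  assumes "B \<subseteq> {1..m} \<times> {1..n}"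
    and "CARD('a::{field,finite}) = q"
  shows "\<exists>M :: int. norm_mat_count TYPE('a) m n d B = of_int M \<and>
    [M = int (rook_number d B) + (int q - 1) *
       (int (graph_rook_number ZG (int d - 2) m n B)
        - int (graph_rook_number SG (int d - 2) m n B)
        + int (graph_rook_number WRG (int d - 1) m n B)
        + int (graph_rook_number WCG (int d - 1) m n B))] (mod (int q - 1)\<^sup>2)"
proof -
  let ?S = "\<lambda>\<sigma>. supp_rank_funs \<sigma> d :: (nat \<times> nat \<Rightarrow> 'a) set"
  \<comment> \<open>\<open>T\<close> represents the weight of \<open>\<sigma>\<close> modulo
    \<open>(q - 1)\<^sup>2\<close>; its sum over \<open>Pow B\<close> is the right-hand side of the
    congruence.\<close>
  define T :: "board \<Rightarrow> int" where
    "T \<sigma> = of_bool (rook_placement \<sigma> \<and> card \<sigma> = d) + (int q - 1) *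
       (of_bool (\<exists>i. d = i + 2 \<and> ZG_placement i \<sigma>) - of_bool (\<exists>i. d = i + 2 \<and> SG_placement i \<sigma>)
        + of_bool (\<exists>i. d = i + 1 \<and> WRG_placement i \<sigma>) + of_bool (\<exists>i. d = i + 1 \<and> WCG_placement i \<sigma>))"
    for \<sigma>
  have finB: "finite B" using assms(1) finite_subset by blast
  have "\<forall>\<sigma>\<in>Pow B. \<exists>w. int (card (?S \<sigma>)) = (int q - 1) ^ d * w \<and> [w = T \<sigma>] (mod (int q - 1)\<^sup>2)"
  proof
    fix \<sigma> assume "\<sigma> \<in> Pow B"
    then have "finite \<sigma>" using finB finite_subset by blast
    from supp_rank_funs_weight[OF this, where 'a = 'a, of d]
    show "\<exists>w. int (card (?S \<sigma>)) = (int q - 1) ^ d * w \<and> [w = T \<sigma>] (mod (int q - 1)\<^sup>2)"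
      unfolding T_def assms(2) .
  qed
  from bchoice[OF this] obtain w where
    w: "\<And>\<sigma>. \<sigma> \<in> Pow B \<Longrightarrow> int (card (?S \<sigma>)) = (int q - 1) ^ d * w \<sigma>"
      "\<And>\<sigma>. \<sigma> \<in> Pow B \<Longrightarrow> [w \<sigma> = T \<sigma>] (mod (int q - 1)\<^sup>2)"
    by blast
  define M where "M = (\<Sum>\<sigma>\<in>Pow B. w \<sigma>)"
  \<comment> \<open>A field has at least two elements, so \<open>(q - 1) ^ d\<close> is nonzero and
    can be cancelled.\<close>
  have "card {0, 1 :: 'a} \<le> CARD('a)" by (intro card_mono) auto
  then have q: "q \<ge> 2" using assms(2) by simp
  have "int (mat_count TYPE('a) m n d B) = (int q - 1) ^ d * M"
    unfolding mat_count_eq_sum[OF assms(1)] M_def sum_distrib_left of_nat_sum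
    by (rule sum.cong) (use w in auto)
  then have "rat_of_int (int (mat_count TYPE('a) m n d B)) = rat_of_int ((int q - 1) ^ d * M)" by simp
  then have "norm_mat_count TYPE('a) m n d B = of_int M"
    using q assms(2) by (simp add: norm_mat_count_def)
  moreover have "[M = (\<Sum>\<sigma>\<in>Pow B. T \<sigma>)] (mod (int q - 1)\<^sup>2)"
    unfolding M_def by (rule cong_sum) (use w in auto)
  moreover have "(\<Sum>\<sigma>\<in>Pow B. T \<sigma>) = int (rook_number d B) + (int q - 1) *
       (int (graph_rook_number ZG (int d - 2) m n B)
        - int (graph_rook_number SG (int d - 2) m n B)
        + int (graph_rook_number WRG (int d - 1) m n B)
        + int (graph_rook_number WCG (int d - 1) m n B))"
  proof -
    \<comment> \<open>Summing an indicator counts the supports of that type, which turns the five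
      sums into rook numbers.\<close>
    have count: "(\<Sum>\<sigma>\<in>Pow B. of_bool (P \<sigma>)) = int (card {\<sigma> \<in> Pow B. P \<sigma>})" for P
      using finB by (simp add: sum_of_bool_eq Int_def)
    show ?thesis
      unfolding T_def sum.distrib sum_distrib_left[symmetric] sum_subtractf count
        rook_number_eq[OF finB] graph_rook_number_ZG[OF assms(1)] graph_rook_number_SG[OF assms(1)]
        graph_rook_number_WRG[OF assms(1)] graph_rook_number_WCG[OF assms(1)] ..
  qed
  ultimately show ?thesis by auto
qed

end
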